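(* The derived category $D^{\le 0}(Ab)$ of abelian groups in degrees $\le 0$ is equivalent to the homotopy category $Ho(Pic_\omega)$, i.e. to the category $Pic_\omega$ of Picard $\omega$-categories localized at the equivalences of $\omega$-categories.
   Context: $D^{\le0}(Ab)$ (cohomological degrees $\le 0$) is the localization at quasi-isomorphisms of the category of chain complexes $\cdots\to C^2\to C^1\to C^0$ of abelian groups concentrated in non-negative homological degrees. $\mathbb N=\{0,1,2,\dots\}$. An $\omega$-category is a set $A$ with maps $s_i,t_i:A\to A$ ($i\in\mathbb N$) and compositions $a*_ib\in A$ defined exactly when $s_ia=t_ib$, such that, with $\rho_i,\sigma_i\in\{s_i,t_i\}$ arbitrary: (1) for all $i$: $\rho_i\sigma_i=\sigma_i$; $a*_is_i(a)=t_i(a)*_ia=a$; $(a*_ib)*_ic=a*_i(b*_ic)$; $s_i(a*_ib)=s_ib$ and $t_i(a*_ib)=t_ia$; (2) for all $i<j$: $\rho_j\sigma_i=\sigma_i$; $\sigma_i\rho_j=\sigma_i$; $\rho_j(a*_ib)=\rho_ja*_i\rho_jb$; $(a*_jb)*_i(\alpha*_j\beta)=(a*_i\alpha)*_j(b*_i\beta)$ whenever both sides are defined; (3) for every $a\in A$ there is $i$ with $s_ia=t_ia=a$. Functors preserve all $s_i,t_i,*_i$; put $A_i:=s_iA$ ($i$-objects). A Picard $\omega$-category is an abelian group object in the category of $\omega$-categories; morphisms in $Pic_\omega$ are additive functors. Two $i$-objects $a,a'$ are isomorphic if there are $u,v\in A_{i+1}$ with $s_iu=a$, $t_iu=a'$,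 $s_iv=a'$, $t_iv=a$, $u*_iv=a'$, $v*_iu=a$; such $u$ is an isomorphism from $a$ to $a'$. A functor $F:A\to B$ is an equivalence if: (a) every $b\in B_0$ is isomorphic to $Fa$ for some $a\in A_0$; (b) for all $i\ge0$ and $a,a'\in A_i$ with $s_{i-1}a=s_{i-1}a'$, $t_{i-1}a=t_{i-1}a'$ (no condition if $i=0$), and every $\psi\in B_{i+1}$ with $s_i\psi=Fa$, $t_i\psi=Fa'$, there are $\phi\in A_{i+1}$ with $s_i\phi=a$, $t_i\phi=a'$ and an isomorphism $\beta\in B_{i+2}$ from $F\phi$ to $\psi$; (c) for $a,a'\in A_i$ with $s_{i-1}a=s_{i-1}a'$, $t_{i-1}a=t_{i-1}a'$ (no condition if $i=0$), if $Fa$ and $Fa'$ are isomorphic then $a$ and $a'$ are isomorphic. *)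

theory Defs
  imports "HOL-Algebra.Coset" "HOL-Library.Equipollence" "HOL-Library.FuncSet"
begin

section \<open>Categories and equivalences of categories\<close>

record ('o, 'm) cat =
  Obj :: "'o set"
  Arr :: "'m set"
  Dom :: "'m \<Rightarrow> 'o"
  Cod :: "'m \<Rightarrow> 'o"
  Ident :: "'o \<Rightarrow> 'm"
  Comp :: "'m \<Rightarrow> 'm \<Rightarrow> 'm"

text \<open>\<open>Comp C g f\<close> is the composite ``g after f''; it is meaningful only if \<open>Dom C g = Cod C f\<close>.\<close>

definition category :: "('o, 'm) cat \<Rightarrow> bool" where
  "category C \<longleftrightarrow>
     (\<forall>f\<in>Arr C. Dom C f \<in> Obj C \<and> Cod C f \<in> Obj C) \<and>
     (\<forall>X\<in>Obj C. Ident C X \<in> Arr C \<and> Dom C (Ident C X) = X \<and> Cod C (Ident C X) = X) \<and>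
     (\<forall>f\<in>Arr C. \<forall>g\<in>Arr C. Dom C g = Cod C f \<longrightarrow>
        Comp C g f \<in> Arr C \<and> Dom C (Comp C g f) = Dom C f \<and> Cod C (Comp C g f) = Cod C g) \<and>
     (\<forall>f\<in>Arr C. Comp C f (Ident C (Dom C f)) = f \<and> Comp C (Ident C (Cod C f)) f = f) \<and>
     (\<forall>f\<in>Arr C. \<forall>g\<in>Arr C. \<forall>h\<in>Arr C. Dom C g = Cod C f \<longrightarrow> Dom C h = Cod C g \<longrightarrow>
        Comp C h (Comp C g f) = Comp C (Comp C h g) f)"

definition iso_arrow :: "('o, 'm) cat \<Rightarrow> 'm \<Rightarrow> bool" where
  "iso_arrow C f \<longleftrightarrow> f \<in> Arr C \<and>
     (\<exists>g\<in>Arr C. Dom C g = Cod C f \<and> Cod C g = Dom C f \<and>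
        Comp C g f = Ident C (Dom C f) \<and> Comp C f g = Ident C (Cod C f))"

definition is_functor ::
    "('o, 'm) cat \<Rightarrow> ('p, 'n) cat \<Rightarrow> ('o \<Rightarrow> 'p) \<Rightarrow> ('m \<Rightarrow> 'n) \<Rightarrow> bool" where
  "is_functor C D Fo Fm \<longleftrightarrow>
     (\<forall>X\<in>Obj C. Fo X \<in> Obj D) \<and>
     (\<forall>f\<in>Arr C. Fm f \<in> Arr D \<and> Dom D (Fm f) = Fo (Dom C f) \<and> Cod D (Fm f) = Fo (Cod C f)) \<and>
     (\<forall>X\<in>Obj C. Fm (Ident C X) = Ident D (Fo X)) \<and>
     (\<forall>f\<in>Arr C. \<forall>g\<in>Arr C. Dom C g = Cod C f \<longrightarrow> Fm (Comp C g f) = Comp D (Fm g) (Fm f))"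

definition natural_iso ::
    "('o, 'm) cat \<Rightarrow> ('p, 'n) cat \<Rightarrow> ('o \<Rightarrow> 'p) \<Rightarrow> ('m \<Rightarrow> 'n) \<Rightarrow> ('o \<Rightarrow> 'p) \<Rightarrow> ('m \<Rightarrow> 'n)
       \<Rightarrow> ('o \<Rightarrow> 'n) \<Rightarrow> bool" where
  "natural_iso C D Fo Fm Go Gm \<eta> \<longleftrightarrow>
     (\<forall>X\<in>Obj C. iso_arrow D (\<eta> X) \<and> Dom D (\<eta> X) = Fo X \<and> Cod D (\<eta> X) = Go X) \<and>
     (\<forall>f\<in>Arr C. Comp D (\<eta> (Cod C f)) (Fm f) = Comp D (Gm f) (\<eta> (Dom C f)))"

definition equivalent_categories :: "('o, 'm) cat \<Rightarrow> ('p, 'n) cat \<Rightarrow> bool" where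
  "equivalent_categories C D \<longleftrightarrow> category C \<and> category D \<and>
     (\<exists>Fo Fm Go Gm \<eta> \<epsilon>.
        is_functor C D Fo Fm \<and> is_functor D C Go Gm \<and>
        natural_iso C C (\<lambda>X. X) (\<lambda>f. f) (\<lambda>X. Go (Fo X)) (\<lambda>f. Gm (Fm f)) \<eta> \<and>
        natural_iso D D (\<lambda>Y. Fo (Go Y)) (\<lambda>g. Fm (Gm g)) (\<lambda>Y. Y) (\<lambda>g. g) \<epsilon>)"


section \<open>Localization of a category\<close>

text \<open>The construction of Gabriel and Zisman: the arrows of the localization of \<open>C\<close> at \<open>W\<close> are the
  zigzags of arrows of \<open>C\<close> and formal inverses of arrows in \<open>W\<close>, modulo the congruence generated by
  the composition of \<open>C\<close> and the cancellation of formal inverses. Zigzags are read from left to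
  right, i.e. in the order opposite to that of \<open>Comp\<close>.\<close>

datatype 'm letter = Fwd 'm | Bwd 'm

inductive zigzag :: "('o, 'm) cat \<Rightarrow> 'm set \<Rightarrow> 'o \<Rightarrow> 'm letter list \<Rightarrow> 'o \<Rightarrow> bool"
  for C W where
    nil: "X \<in> Obj C \<Longrightarrow> zigzag C W X [] X"
  | fwd: "f \<in> Arr C \<Longrightarrow> zigzag C W (Cod C f) p Y \<Longrightarrow> zigzag C W (Dom C f) (Fwd f # p) Y"
  | bwd: "w \<in> Arr C \<Longrightarrow> w \<in> W \<Longrightarrow> zigzag C W (Dom C w) p Y
            \<Longrightarrow> zigzag C W (Cod C w) (Bwd w # p) Y"

inductive zz_eq ::
    "('o, 'm) cat \<Rightarrow> 'm set \<Rightarrow> 'o \<Rightarrow> 'm letter list \<Rightarrow> 'm letter list \<Rightarrow> 'o \<Rightarrow> bool"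
  for C W where
    refl: "zigzag C W X p Y \<Longrightarrow> zz_eq C W X p p Y"
  | sym: "zz_eq C W X p q Y \<Longrightarrow> zz_eq C W X q p Y"
  | trans: "zz_eq C W X p q Y \<Longrightarrow> zz_eq C W X q r Y \<Longrightarrow> zz_eq C W X p r Y"
  | append: "zz_eq C W X p q Y \<Longrightarrow> zz_eq C W Y p' q' Z \<Longrightarrow> zz_eq C W X (p @ p') (q @ q') Z"
  | ident: "X \<in> Obj C \<Longrightarrow> zz_eq C W X [Fwd (Ident C X)] [] X"
  | comp: "f \<in> Arr C \<Longrightarrow> g \<in> Arr C \<Longrightarrow> Dom C g = Cod C f \<Longrightarrow>
             zz_eq C W (Dom C f) [Fwd f, Fwd g] [Fwd (Comp C g f)] (Cod C g)"
  | cancel_left: "w \<in> Arr C \<Longrightarrow> w \<in> W \<Longrightarrow> zz_eq C W (Dom C w) [Fwd w, Bwd w] [] (Dom C w)"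
  | cancel_right: "w \<in> Arr C \<Longrightarrow> w \<in> W \<Longrightarrow> zz_eq C W (Cod C w) [Bwd w, Fwd w] [] (Cod C w)"

definition zz_arrow ::
    "('o, 'm) cat \<Rightarrow> 'm set \<Rightarrow> 'o \<Rightarrow> 'm letter list \<Rightarrow> 'o \<Rightarrow> 'o \<times> 'm letter list set \<times> 'o" where
  "zz_arrow C W X p Y = (X, {q. zz_eq C W X p q Y}, Y)"

definition localization ::
    "('o, 'm) cat \<Rightarrow> 'm set \<Rightarrow> ('o, 'o \<times> 'm letter list set \<times> 'o) cat" where
  "localization C W =
     \<lparr> Obj = Obj C,
       Arr = {zz_arrow C W X p Y | X p Y. zigzag C W X p Y},
       Dom = (\<lambda>(X, P, Y). X),
       Cod = (\<lambda>(X, P, Y). Y),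
       Ident = (\<lambda>X. zz_arrow C W X [] X),
       Comp = (\<lambda>(Y, Q, Z) (X, P, Y'). (X, {r. \<exists>p\<in>P. \<exists>q\<in>Q. zz_eq C W X (p @ q) r Z}, Z)) \<rparr>"

definition localize :: "('o, 'm) cat \<Rightarrow> 'm set \<Rightarrow> 'm \<Rightarrow> 'o \<times> 'm letter list set \<times> 'o" where
  "localize C W f = zz_arrow C W (Dom C f) [Fwd f] (Cod C f)"

text \<open>The remainder of this section proves that the construction has the universal property of
  the localization.\<close>

lemma zigzag_append:
  assumes "zigzag C W X p Y" "zigzag C W Y q Z"
  shows "zigzag C W X (p @ q) Z"
  using assms by induction (auto intro: zigzag.intros)

lemma zigzag_ends:
  assumes "category C" "zigzag C W X p Y"
  shows "X \<in> Obj C \<and> Y \<in> Obj C"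
  using assms(2,1) by induction (auto simp: category_def)

lemma zz_eq_zigzag:
  assumes "category C" "zz_eq C W X p q Y"
  shows "zigzag C W X p Y \<and> zigzag C W X q Y"
  using assms(2)
proof induction
  case (ident X)
  then have "zigzag C W (Dom C (Ident C X)) [Fwd (Ident C X)] X"
    using assms(1) by (intro zigzag.fwd) (auto simp: category_def intro: zigzag.nil)
  with ident assms(1) show ?case by (auto simp: category_def intro: zigzag.nil)
next
  case (comp f g)
  have 1: "zigzag C W (Dom C (Comp C g f)) [Fwd (Comp C g f)] (Cod C g)"
    using assms(1) comp by (intro zigzag.fwd) (auto simp: category_def intro: zigzag.nil)
  have "zigzag C W (Dom C g) [Fwd g] (Cod C g)"
    using assms(1) comp by (intro zigzag.fwd) (auto simp: category_def intro: zigzag.nil)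
  then have "zigzag C W (Dom C f) [Fwd f, Fwd g] (Cod C g)"
    using comp by (intro zigzag.fwd) auto
  with 1 comp assms(1) show ?case by (auto simp: category_def)
next
  case (cancel_left w)
  then show ?case using assms(1)
    by (auto simp: category_def intro!: zigzag.intros)
next
  case (cancel_right w)
  then show ?case using assms(1)
    by (auto simp: category_def intro!: zigzag.intros)
qed (auto intro: zigzag_append)

lemma zz_arrow_eq_iff:
  assumes "zigzag C W X p Y"
  shows "zz_arrow C W X p Y = zz_arrow C W X' q Y' \<longleftrightarrow> X = X' \<and> Y = Y' \<and> zz_eq C W X q p Y"
  using assms unfolding zz_arrow_def
  by (auto intro: zz_eq.refl zz_eq.sym zz_eq.trans)

lemma localization_comp:
  assumes "category C" "zigzag C W X p Y" "zigzag C W Y q Z"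
  shows "Comp (localization C W) (zz_arrow C W Y q Z) (zz_arrow C W X p Y)
           = zz_arrow C W X (p @ q) Z"
proof -
  have "(\<exists>p'. zz_eq C W X p p' Y \<and> (\<exists>q'. zz_eq C W Y q q' Z \<and> zz_eq C W X (p' @ q') r Z))
          \<longleftrightarrow> zz_eq C W X (p @ q) r Z" for r
    using assms(2,3) by (meson zz_eq.append zz_eq.refl zz_eq.trans)
  then show ?thesis by (simp add: localization_def zz_arrow_def Bex_def)
qed

lemma localization_simps:
  "Obj (localization C W) = Obj C"
  "Arr (localization C W) = {zz_arrow C W X p Y | X p Y. zigzag C W X p Y}"
  "Dom (localization C W) (zz_arrow C W X p Y) = X"
  "Cod (localization C W) (zz_arrow C W X p Y) = Y"
  "Ident (localization C W) X = zz_arrow C W X [] X"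
  by (simp_all add: localization_def zz_arrow_def)

lemma category_localization:
  assumes "category C"
  shows "category (localization C W)"
proof -
  let ?L = "localization C W"
  have ends: "X \<in> Obj C" "Y \<in> Obj C" if "zigzag C W X p Y" for X p Y
    using zigzag_ends[OF assms that] by auto
  have ne: "Comp ?L (zz_arrow C W X p Y) (zz_arrow C W X [] X) = zz_arrow C W X p Y"
      "Comp ?L (zz_arrow C W Y [] Y) (zz_arrow C W X p Y) = zz_arrow C W X p Y"
    if "zigzag C W X p Y" for X p Y
    using localization_comp[OF assms zigzag.nil that] localization_comp[OF assms that zigzag.nil]
      ends[OF that] by simp_all
  have arr: "zz_arrow C W X p Y \<in> Arr ?L" if "zigzag C W X p Y" for X p Y
    using that by (auto simp: localization_simps)
  have all: "(\<forall>f\<in>Arr ?L. P f) \<longleftrightarrow> (\<forall>X p Y. zigzag C W X p Y \<longrightarrow> P (zz_arrow C W X p Y))" for P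
    unfolding localization_simps by blast
  show ?thesis
    unfolding category_def all
    by (auto simp: localization_simps(1,3-) localization_comp[OF assms] arr zigzag_append
        zigzag.nil ne dest: ends)
qed

lemma zigzag_single:
  assumes "category C" "f \<in> Arr C"
  shows "zigzag C W (Dom C f) [Fwd f] (Cod C f)"
  using assms by (auto simp: category_def intro!: zigzag.intros)

lemma zigzag_single_bwd:
  assumes "category C" "w \<in> Arr C" "w \<in> W"
  shows "zigzag C W (Cod C w) [Bwd w] (Dom C w)"
  using assms by (auto simp: category_def intro!: zigzag.intros)

lemma localize_functor:
  assumes "category C"
  shows "is_functor C (localization C W) (\<lambda>X. X) (localize C W)"
proof -
  have "localize C W (Ident C X) = zz_arrow C W X [] X" if "X \<in> Obj C" for X
  proof -
    have "Dom C (Ident C X) = X" "Cod C (Ident C X) = X"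
      using assms that by (auto simp: category_def)
    then show ?thesis
      using zz_arrow_eq_iff[OF zigzag.nil[OF that, of W]] zz_eq.ident[OF that, of W]
      by (metis localize_def)
  qed
  moreover have "localize C W (Comp C g f)
      = Comp (localization C W) (localize C W g) (localize C W f)"
    if "f \<in> Arr C" "g \<in> Arr C" "Dom C g = Cod C f" for f g
  proof -
    have z: "zigzag C W (Dom C f) [Fwd f] (Cod C f)" "zigzag C W (Cod C f) [Fwd g] (Cod C g)"
      using zigzag_single[OF assms] that by metis+
    have "Dom C (Comp C g f) = Dom C f" "Cod C (Comp C g f) = Cod C g"
      using assms that by (auto simp: category_def)
    then show ?thesis
      using zz_arrow_eq_iff[OF zigzag_append[OF z]] zz_eq.comp[OF that, of W]
        localization_comp[OF assms z] that(3)
      by (simp add: localize_def) (metis zz_eq.sym)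
  qed
  moreover have "localize C W f \<in> Arr (localization C W)" if "f \<in> Arr C" for f
    using zigzag_single[OF assms that] by (auto simp: localize_def localization_simps)
  ultimately show ?thesis
    unfolding is_functor_def by (simp add: localization_simps(1,5)) (simp add: localize_def localization_simps(3,4))
qed

lemma localize_inverts:
  assumes "category C" "w \<in> Arr C" "w \<in> W"
  shows "iso_arrow (localization C W) (localize C W w)"
proof -
  have ob: "Dom C w \<in> Obj C" "Cod C w \<in> Obj C"
    using assms by (auto simp: category_def)
  note z = zigzag_single[OF assms(1,2), of W] zigzag_single_bwd[OF assms]
  have "zz_arrow C W (Dom C w) [Fwd w, Bwd w] (Dom C w) = zz_arrow C W (Dom C w) [] (Dom C w)"
       "zz_arrow C W (Cod C w) [Bwd w, Fwd w] (Cod C w) = zz_arrow C W (Cod C w) [] (Cod C w)"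
    using zz_arrow_eq_iff[OF zigzag.nil[OF ob(1)]] zz_arrow_eq_iff[OF zigzag.nil[OF ob(2)]]
      zz_eq.cancel_left[OF assms(2,3)] zz_eq.cancel_right[OF assms(2,3)] by metis+
  moreover have "localize C W w \<in> Arr (localization C W)"
      "zz_arrow C W (Cod C w) [Bwd w] (Dom C w) \<in> Arr (localization C W)"
    using z by (auto simp: localize_def localization_simps)
  ultimately show ?thesis
    using localization_comp[OF assms(1) z] localization_comp[OF assms(1) z(2,1)]
    unfolding iso_arrow_def localize_def
    by (intro conjI bexI[of _ "zz_arrow C W (Cod C w) [Bwd w] (Dom C w)"])
      (simp_all add: localization_simps(3-))
qed

lemma functor_arrD:
  assumes "is_functor C D Fo Fm" "f \<in> Arr C"
  shows "Fm f \<in> Arr D \<and> Dom D (Fm f) = Fo (Dom C f) \<and> Cod D (Fm f) = Fo (Cod C f)"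
  using assms by (simp add: is_functor_def)

lemma functor_identD:
  assumes "is_functor C D Fo Fm" "X \<in> Obj C"
  shows "Fm (Ident C X) = Ident D (Fo X)"
  using assms by (simp add: is_functor_def)

lemma functor_compD:
  assumes "is_functor C D Fo Fm" "f \<in> Arr C" "g \<in> Arr C" "Dom C g = Cod C f"
  shows "Fm (Comp C g f) = Comp D (Fm g) (Fm f)"
  using assms by (simp add: is_functor_def)

lemma category_identD:
  assumes "category C" "f \<in> Arr C"
  shows "Comp C f (Ident C (Dom C f)) = f" "Comp C (Ident C (Cod C f)) f = f"
  using assms by (simp_all add: category_def)

lemma category_assocD:
  assumes "category C" "f \<in> Arr C" "g \<in> Arr C" "h \<in> Arr C"
    "Dom C g = Cod C f" "Dom C h = Cod C g"
  shows "Comp C h (Comp C g f) = Comp C (Comp C h g) f"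
  using assms by (simp add: category_def)

primrec eval_zigzag ::
    "('p, 'n) cat \<Rightarrow> ('o \<Rightarrow> 'p) \<Rightarrow> ('m \<Rightarrow> 'n) \<Rightarrow> 'o \<Rightarrow> 'm letter list \<Rightarrow> 'n" where
  "eval_zigzag D Fo Fm Y [] = Ident D (Fo Y)"
| "eval_zigzag D Fo Fm Y (l # p) = Comp D (eval_zigzag D Fo Fm Y p)
     (case l of
        Fwd f \<Rightarrow> Fm f
      | Bwd w \<Rightarrow> (SOME v. v \<in> Arr D \<and> Dom D v = Cod D (Fm w) \<and> Cod D v = Dom D (Fm w) \<and>
          Comp D v (Fm w) = Ident D (Dom D (Fm w)) \<and> Comp D (Fm w) v = Ident D (Cod D (Fm w))))"

context
  fixes C :: "('o, 'm) cat" and D :: "('p, 'n) cat" and W Fo Fm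
  assumes C: "category C" and D: "category D" and F: "is_functor C D Fo Fm"
    and W: "\<And>w. w \<in> W \<Longrightarrow> w \<in> Arr C \<Longrightarrow> iso_arrow D (Fm w)"
begin

private abbreviation "ev \<equiv> eval_zigzag D Fo Fm"
private abbreviation "iv w \<equiv>
  (SOME v. v \<in> Arr D \<and> Dom D v = Cod D (Fm w) \<and> Cod D v = Dom D (Fm w) \<and>
     Comp D v (Fm w) = Ident D (Dom D (Fm w)) \<and> Comp D (Fm w) v = Ident D (Cod D (Fm w)))"

private lemma iv:
  assumes "w \<in> W" "w \<in> Arr C"
  shows "iv w \<in> Arr D \<and> Dom D (iv w) = Fo (Cod C w) \<and> Cod D (iv w) = Fo (Dom C w) \<and>
     Comp D (iv w) (Fm w) = Ident D (Fo (Dom C w)) \<and> Comp D (Fm w) (iv w) = Ident D (Fo (Cod C w))"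
proof -
  have "\<exists>v. v \<in> Arr D \<and> Dom D v = Cod D (Fm w) \<and> Cod D v = Dom D (Fm w) \<and>
     Comp D v (Fm w) = Ident D (Dom D (Fm w)) \<and> Comp D (Fm w) v = Ident D (Cod D (Fm w))"
    using W[OF assms] unfolding iso_arrow_def by blast
  from someI_ex[OF this] show ?thesis using F assms by (simp add: is_functor_def)
qed

private lemma ev_arr:
  assumes "zigzag C W X p Y"
  shows "ev Y p \<in> Arr D \<and> Dom D (ev Y p) = Fo X \<and> Cod D (ev Y p) = Fo Y"
  using assms
proof induction
  case (nil X)
  then show ?case using F D by (auto simp: is_functor_def category_def)
next
  case (fwd f p Y)
  then show ?case using F D by (auto simp: is_functor_def category_def)
next
  case (bwd w p Y)
  then show ?case using iv[of w] D by (auto simp: category_def)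
qed

private lemma ev_append:
  assumes "zigzag C W X p Y" "zigzag C W Y q Z"
  shows "ev Z (p @ q) = Comp D (ev Z q) (ev Y p)"
  using assms
proof induction
  case (nil X)
  then show ?case using ev_arr[OF nil(2)] D by (auto simp: category_def)
next
  case (fwd f p Y)
  then show ?case using ev_arr[OF fwd(2)] ev_arr[OF fwd(4)] F D
    by (auto simp: is_functor_def category_def)
next
  case (bwd w p Y)
  then show ?case using ev_arr[OF bwd(3)] ev_arr[OF bwd(5)] iv[of w] D
    by (auto simp: category_def)
qed

private lemma ev_eq:
  assumes "zz_eq C W X p q Y"
  shows "ev Y p = ev Y q"
  using assms
proof induction
  case (append X p q Y p' q' Z)
  then show ?case using ev_append zz_eq_zigzag[OF C] by metis
next
  case (ident X)
  then have "Fo X \<in> Obj D" "Fm (Ident C X) = Ident D (Fo X)"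
    using F by (simp_all add: is_functor_def)
  then show ?case using D category_identD(1)[OF D, of "Ident D (Fo X)"] by (simp add: category_def)
next
  case (comp f g)
  have "Comp D (Ident D (Fo (Cod C g))) (Fm g) = Fm g"
    using functor_arrD[OF F comp(2)] category_identD(2)[OF D, of "Fm g"] by simp
  moreover have "Comp D (Ident D (Fo (Cod C g))) (Fm (Comp C g f)) = Fm (Comp C g f)"
  proof -
    have "Comp C g f \<in> Arr C" "Cod C (Comp C g f) = Cod C g"
      using C comp by (auto simp: category_def)
    then show ?thesis
      using functor_arrD[OF F, of "Comp C g f"] category_identD(2)[OF D, of "Fm (Comp C g f)"]
      by simp
  qed
  ultimately show ?case using functor_compD[OF F comp] by simp
next
  case (cancel_left w)
  note i = iv[OF cancel_left(2,1)]
  have "Comp D (Ident D (Fo (Dom C w))) (iv w) = iv w"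
    using i category_identD(2)[OF D, of "iv w"] by simp
  with i have "Comp D (Comp D (Ident D (Fo (Dom C w))) (iv w)) (Fm w) = Ident D (Fo (Dom C w))"
    by simp
  then show ?case by simp
next
  case (cancel_right w)
  note i = iv[OF cancel_right(2,1)]
  have "Comp D (Ident D (Fo (Cod C w))) (Fm w) = Fm w"
    using functor_arrD[OF F cancel_right(1)] category_identD(2)[OF D, of "Fm w"] by simp
  with i have "Comp D (Comp D (Ident D (Fo (Cod C w))) (Fm w)) (iv w) = Ident D (Fo (Cod C w))"
    by simp
  then show ?case by simp
qed auto

lemma localization_universal_existence:
  "\<exists>Gm. is_functor (localization C W) D Fo Gm \<and> (\<forall>f\<in>Arr C. Gm (localize C W f) = Fm f)"
proof -
  define Gm where "Gm = (\<lambda>(X :: 'o, P, Y). ev Y (SOME p. p \<in> P))"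
  have G: "Gm (zz_arrow C W X p Y) = ev Y p" if "zigzag C W X p Y" for X p Y
  proof -
    have "zz_eq C W X p (SOME q. zz_eq C W X p q Y) Y"
      using someI[of "\<lambda>q. zz_eq C W X p q Y" p] zz_eq.refl[OF that] by blast
    from ev_eq[OF this] show ?thesis by (simp add: Gm_def zz_arrow_def)
  qed
  have "is_functor (localization C W) D Fo Gm"
    unfolding is_functor_def
    using F C by (auto simp: localization_simps G ev_arr localization_comp zigzag_append ev_append
        zigzag.nil is_functor_def)
  moreover have "Gm (localize C W f) = Fm f" if "f \<in> Arr C" for f
  proof -
    have "Fm f \<in> Arr D" "Cod D (Fm f) = Fo (Cod C f)"
      using F that by (simp_all add: is_functor_def)
    then have "Comp D (Ident D (Fo (Cod C f))) (Fm f) = Fm f"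
      using category_identD(2)[OF D, of "Fm f"] by simp
    then show ?thesis
      using G[OF zigzag_single[OF C that]] by (simp add: localize_def)
  qed
  ultimately show ?thesis by blast
qed

end

lemma localization_universal_uniqueness:
  assumes C: "category C" and D: "category D"
    and G: "is_functor (localization C W) D Fo Gm" and H: "is_functor (localization C W) D Fo Hm"
    and GH: "\<And>f. f \<in> Arr C \<Longrightarrow> Gm (localize C W f) = Hm (localize C W f)"
    and a: "a \<in> Arr (localization C W)"
  shows "Gm a = Hm a"
proof -
  let ?L = "localization C W"
  have "Gm (zz_arrow C W X p Y) = Hm (zz_arrow C W X p Y)" if "zigzag C W X p Y" for X p Y
    using that
  proof induction
    case (nil X)
    then show ?case using G H by (simp add: is_functor_def localization_simps)
  next
    case (fwd f p Y)
    note z = zigzag_single[OF C fwd(1), of W]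
    have e: "zz_arrow C W (Dom C f) (Fwd f # p) Y
        = Comp ?L (zz_arrow C W (Cod C f) p Y) (localize C W f)"
      using localization_comp[OF C z fwd(2)] by (simp add: localize_def)
    have m: "localize C W f \<in> Arr ?L" "zz_arrow C W (Cod C f) p Y \<in> Arr ?L"
      "Dom ?L (zz_arrow C W (Cod C f) p Y) = Cod ?L (localize C W f)"
      using z fwd(2) by (auto simp: localize_def localization_simps)
    show ?case using functor_compD[OF G m] functor_compD[OF H m] GH[OF fwd(1)] fwd(3)
      unfolding e by simp
  next
    case (bwd w p Y)
    let ?b = "zz_arrow C W (Cod C w) [Bwd w] (Dom C w)" and ?f = "localize C W w"
    note z = zigzag_single_bwd[OF C bwd(1,2)] and zf = zigzag_single[OF C bwd(1), of W]
    have ob: "Dom C w \<in> Obj C" "Cod C w \<in> Obj C" using C bwd(1) by (auto simp: category_def)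
    have e: "zz_arrow C W (Cod C w) (Bwd w # p) Y = Comp ?L (zz_arrow C W (Dom C w) p Y) ?b"
      using localization_comp[OF C z bwd(3)] by simp
    have m: "?b \<in> Arr ?L" "?f \<in> Arr ?L" "zz_arrow C W (Dom C w) p Y \<in> Arr ?L"
        "Dom ?L ?b = Cod C w" "Cod ?L ?b = Dom C w" "Dom ?L ?f = Dom C w" "Cod ?L ?f = Cod C w"
        "Dom ?L (zz_arrow C W (Dom C w) p Y) = Dom C w"
      using z zf bwd(3) by (auto simp: localize_def localization_simps)
    have i: "Comp ?L ?b ?f = Ident ?L (Dom C w)" "Comp ?L ?f ?b = Ident ?L (Cod C w)"
      using localization_comp[OF C zf z] localization_comp[OF C z zf]
        zz_arrow_eq_iff[OF zigzag.nil[OF ob(1)]] zz_arrow_eq_iff[OF zigzag.nil[OF ob(2)]]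
        zz_eq.cancel_left[OF bwd(1,2)] zz_eq.cancel_right[OF bwd(1,2)]
      by (simp_all add: localize_def localization_simps) metis+
    have inv: "Km ?b \<in> Arr D \<and> Km ?f \<in> Arr D \<and> Dom D (Km ?b) = Fo (Cod C w) \<and>
        Cod D (Km ?b) = Fo (Dom C w) \<and> Dom D (Km ?f) = Fo (Dom C w) \<and>
        Cod D (Km ?f) = Fo (Cod C w) \<and> Comp D (Km ?b) (Km ?f) = Ident D (Fo (Dom C w)) \<and>
        Comp D (Km ?f) (Km ?b) = Ident D (Fo (Cod C w))"
      if "is_functor ?L D Fo Km" for Km
      using functor_arrD[OF that m(1)] functor_arrD[OF that m(2)]
        functor_compD[OF that m(2,1)] functor_compD[OF that m(1,2)]
        functor_identD[OF that, of "Dom C w"] functor_identD[OF that, of "Cod C w"] m ob i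
      by (simp add: localization_simps(1))
    have f: "Gm ?f = Hm ?f" using GH bwd(1) by simp
    note g = inv[OF G] and h = inv[OF H]
    have "Gm ?b = Comp D (Gm ?b) (Comp D (Gm ?f) (Hm ?b))"
      using g h category_identD(1)[OF D, of "Gm ?b"] by (simp add: f)
    also have "\<dots> = Comp D (Comp D (Gm ?b) (Gm ?f)) (Hm ?b)"
      using g h by (intro category_assocD[OF D]) (simp_all add: f)
    also have "\<dots> = Hm ?b"
      using g h category_identD(2)[OF D, of "Hm ?b"] by simp
    finally have b: "Gm ?b = Hm ?b" .
    show ?case
      using functor_compD[OF G m(1,3)] functor_compD[OF H m(1,3)] m b bwd(4) unfolding e by simp
  qed
  then show ?thesis using a by (auto simp: localization_simps)
qed


section \<open>Universes\<close>

text \<open>The categories below consist of the objects that are small with respect to a collection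
  \<open>U\<close> of ``small'' subsets of a type. Grothendieck universes containing an infinite set satisfy
  this condition, but closure under power sets is not required: \<open>U\<close> may also consist of all subsets
  of an infinite type.\<close>

definition universe :: "'u set set \<Rightarrow> bool" where
  "universe U \<longleftrightarrow>
     (\<exists>X\<in>U. infinite X) \<and>
     (\<forall>X\<in>U. \<forall>Y :: 'u set. Y \<lesssim> X \<longrightarrow> Y \<in> U) \<and>
     (\<forall>X :: nat \<Rightarrow> 'u set. (\<forall>n. X n \<in> U) \<longrightarrow> (\<Union>n. X n) \<in> U)"

lemma universe_UNIV: "infinite (UNIV :: 'u set) \<Longrightarrow> universe (UNIV :: 'u set set)"
  by (auto simp: universe_def)


section \<open>Chain complexes and their derived category\<close>

text \<open>A complex \<open>\<dots> \<rightarrow> C 2 \<rightarrow> C 1 \<rightarrow> C 0\<close>; \<open>bd C n\<close> is the differential from degree \<open>n + 1\<close> to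
  degree \<open>n\<close>. Abelian groups are written multiplicatively, following \<open>comm_group\<close>.\<close>

record 'u complex =
  grp :: "nat \<Rightarrow> 'u monoid"
  bd :: "nat \<Rightarrow> 'u \<Rightarrow> 'u"

definition chain_complex :: "'u complex \<Rightarrow> bool" where
  "chain_complex C \<longleftrightarrow>
     (\<forall>n. comm_group (grp C n)) \<and>
     (\<forall>n. bd C n \<in> hom (grp C (Suc n)) (grp C n)) \<and>
     (\<forall>n. \<forall>x\<in>carrier (grp C (Suc (Suc n))). bd C n (bd C (Suc n) x) = \<one>\<^bsub>grp C n\<^esub>)"

definition chain_map :: "'u complex \<Rightarrow> 'u complex \<Rightarrow> (nat \<Rightarrow> 'u \<Rightarrow> 'u) \<Rightarrow> bool" where
  "chain_map C D f \<longleftrightarrow>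
     (\<forall>n. f n \<in> hom (grp C n) (grp D n) \<and> f n \<in> extensional (carrier (grp C n))) \<and>
     (\<forall>n. \<forall>x\<in>carrier (grp C (Suc n)). f n (bd C n x) = bd D n (f (Suc n) x))"

definition cycles :: "'u complex \<Rightarrow> nat \<Rightarrow> 'u set" where
  "cycles C n = (case n of 0 \<Rightarrow> carrier (grp C 0)
                         | Suc m \<Rightarrow> kernel (grp C (Suc m)) (grp C m) (bd C m))"

definition boundaries :: "'u complex \<Rightarrow> nat \<Rightarrow> 'u set" where
  "boundaries C n = bd C n ` carrier (grp C (Suc n))"

definition homology :: "'u complex \<Rightarrow> nat \<Rightarrow> 'u set monoid" where
  "homology C n = (grp C n)\<lparr>carrier := cycles C n\<rparr> Mod boundaries C n"

text \<open>The image under \<open>f\<close> of the class \<open>B\<^sub>C + z\<close> generates the class \<open>B\<^sub>D + f z\<close>.\<close>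

definition homology_map ::
    "'u complex \<Rightarrow> (nat \<Rightarrow> 'u \<Rightarrow> 'u) \<Rightarrow> nat \<Rightarrow> 'u set \<Rightarrow> 'u set" where
  "homology_map D f n K = boundaries D n <#>\<^bsub>grp D n\<^esub> (f n ` K)"

definition quasi_iso :: "'u complex \<Rightarrow> 'u complex \<Rightarrow> (nat \<Rightarrow> 'u \<Rightarrow> 'u) \<Rightarrow> bool" where
  "quasi_iso C D f \<longleftrightarrow> chain_map C D f \<and>
     (\<forall>n. homology_map D f n \<in> iso (homology C n) (homology D n))"

type_synonym 'u complex_arrow = "'u complex \<times> (nat \<Rightarrow> 'u \<Rightarrow> 'u) \<times> 'u complex"

definition small_complexes :: "'u set set \<Rightarrow> 'u complex set" where
  "small_complexes U = {C. chain_complex C \<and> (\<forall>n. carrier (grp C n) \<in> U)}"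

definition Ch :: "'u set set \<Rightarrow> ('u complex, 'u complex_arrow) cat" where
  "Ch U =
     \<lparr> Obj = small_complexes U,
       Arr = {(C, f, D). C \<in> small_complexes U \<and> D \<in> small_complexes U \<and> chain_map C D f},
       Dom = (\<lambda>(C, f, D). C),
       Cod = (\<lambda>(C, f, D). D),
       Ident = (\<lambda>C. (C, \<lambda>n. restrict (\<lambda>x. x) (carrier (grp C n)), C)),
       Comp = (\<lambda>(D, g, E) (C, f, D'). (C, \<lambda>n. compose (carrier (grp C n)) (g n) (f n), E)) \<rparr>"

definition derived_category ::
    "'u set set \<Rightarrow>
       ('u complex, 'u complex \<times> 'u complex_arrow letter list set \<times> 'u complex) cat" where
  "derived_category U = localization (Ch U) {(C, f, D). (C, f, D) \<in> Arr (Ch U) \<and> quasi_iso C D f}"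


section \<open>\<open>\<omega>\<close>-categories\<close>

text \<open>\<open>Cmp A i a b\<close> stands for \<open>a *\<^sub>i b\<close>; only its values at pairs with \<open>composable A i a b\<close> are
  meaningful.\<close>

record 'a omega_cat =
  Cells :: "'a set"
  Src :: "nat \<Rightarrow> 'a \<Rightarrow> 'a"
  Tgt :: "nat \<Rightarrow> 'a \<Rightarrow> 'a"
  Cmp :: "nat \<Rightarrow> 'a \<Rightarrow> 'a \<Rightarrow> 'a"

definition composable :: "'a omega_cat \<Rightarrow> nat \<Rightarrow> 'a \<Rightarrow> 'a \<Rightarrow> bool" where
  "composable A i a b \<longleftrightarrow> a \<in> Cells A \<and> b \<in> Cells A \<and> Src A i a = Tgt A i b"

definition omega_category :: "'a omega_cat \<Rightarrow> bool" where
  "omega_category A \<longleftrightarrow>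
     (\<forall>i. \<forall>a\<in>Cells A. Src A i a \<in> Cells A \<and> Tgt A i a \<in> Cells A) \<and>
     (\<forall>i a b. composable A i a b \<longrightarrow> Cmp A i a b \<in> Cells A) \<and>
     (\<forall>\<rho>\<in>{Src A, Tgt A}. \<forall>\<sigma>\<in>{Src A, Tgt A}. \<forall>i. \<forall>a\<in>Cells A. \<rho> i (\<sigma> i a) = \<sigma> i a) \<and>
     (\<forall>i. \<forall>a\<in>Cells A. Cmp A i a (Src A i a) = a \<and> Cmp A i (Tgt A i a) a = a) \<and>
     (\<forall>i a b c. composable A i a b \<longrightarrow> composable A i b c \<longrightarrow>
        Cmp A i (Cmp A i a b) c = Cmp A i a (Cmp A i b c)) \<and>
     (\<forall>i a b. composable A i a b \<longrightarrow>
        Src A i (Cmp A i a b) = Src A i b \<and> Tgt A i (Cmp A i a b) = Tgt A i a) \<and>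
     (\<forall>\<rho>\<in>{Src A, Tgt A}. \<forall>\<sigma>\<in>{Src A, Tgt A}. \<forall>i j. i < j \<longrightarrow>
        (\<forall>a\<in>Cells A. \<rho> j (\<sigma> i a) = \<sigma> i a \<and> \<sigma> i (\<rho> j a) = \<sigma> i a)) \<and>
     (\<forall>\<rho>\<in>{Src A, Tgt A}. \<forall>i j a b. i < j \<longrightarrow> composable A i a b \<longrightarrow>
        \<rho> j (Cmp A i a b) = Cmp A i (\<rho> j a) (\<rho> j b)) \<and>
     (\<forall>i j a b \<alpha> \<beta>. i < j \<longrightarrow>
        composable A j a b \<longrightarrow> composable A j \<alpha> \<beta> \<longrightarrow>
        composable A i (Cmp A j a b) (Cmp A j \<alpha> \<beta>) \<longrightarrow>
        composable A i a \<alpha> \<longrightarrow> composable A i b \<beta> \<longrightarrow>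
        composable A j (Cmp A i a \<alpha>) (Cmp A i b \<beta>) \<longrightarrow>
        Cmp A i (Cmp A j a b) (Cmp A j \<alpha> \<beta>) = Cmp A j (Cmp A i a \<alpha>) (Cmp A i b \<beta>)) \<and>
     (\<forall>a\<in>Cells A. \<exists>i. Src A i a = a \<and> Tgt A i a = a)"

definition omega_functor :: "'a omega_cat \<Rightarrow> 'b omega_cat \<Rightarrow> ('a \<Rightarrow> 'b) \<Rightarrow> bool" where
  "omega_functor A B F \<longleftrightarrow>
     (\<forall>a\<in>Cells A. F a \<in> Cells B) \<and>
     (\<forall>i. \<forall>a\<in>Cells A. F (Src A i a) = Src B i (F a) \<and> F (Tgt A i a) = Tgt B i (F a)) \<and>
     (\<forall>i a b. composable A i a b \<longrightarrow> F (Cmp A i a b) = Cmp B i (F a) (F b))"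

definition i_objects :: "'a omega_cat \<Rightarrow> nat \<Rightarrow> 'a set" where
  "i_objects A i = Src A i ` Cells A"

definition cell_iso :: "'a omega_cat \<Rightarrow> nat \<Rightarrow> 'a \<Rightarrow> 'a \<Rightarrow> 'a \<Rightarrow> bool" where
  "cell_iso A i u a a' \<longleftrightarrow> a \<in> i_objects A i \<and> a' \<in> i_objects A i \<and> u \<in> i_objects A (Suc i) \<and>
     Src A i u = a \<and> Tgt A i u = a' \<and>
     (\<exists>v\<in>i_objects A (Suc i). Src A i v = a' \<and> Tgt A i v = a \<and> Cmp A i u v = a' \<and> Cmp A i v u = a)"

definition cells_isomorphic :: "'a omega_cat \<Rightarrow> nat \<Rightarrow> 'a \<Rightarrow> 'a \<Rightarrow> bool" where
  "cells_isomorphic A i a a' \<longleftrightarrow> (\<exists>u. cell_iso A i u a a')"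

definition parallel_cells :: "'a omega_cat \<Rightarrow> nat \<Rightarrow> 'a \<Rightarrow> 'a \<Rightarrow> bool" where
  "parallel_cells A i a a' \<longleftrightarrow> a \<in> i_objects A i \<and> a' \<in> i_objects A i \<and>
     (i > 0 \<longrightarrow> Src A (i - 1) a = Src A (i - 1) a' \<and> Tgt A (i - 1) a = Tgt A (i - 1) a')"

definition omega_equivalence :: "'a omega_cat \<Rightarrow> 'b omega_cat \<Rightarrow> ('a \<Rightarrow> 'b) \<Rightarrow> bool" where
  "omega_equivalence A B F \<longleftrightarrow> omega_functor A B F \<and>
     (\<forall>b\<in>i_objects B 0. \<exists>a\<in>i_objects A 0. cells_isomorphic B 0 b (F a)) \<and>
     (\<forall>i a a'. parallel_cells A i a a' \<longrightarrow>
        (\<forall>\<psi>\<in>i_objects B (Suc i). Src B i \<psi> = F a \<longrightarrow> Tgt B i \<psi> = F a' \<longrightarrow>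
           (\<exists>\<phi>\<in>i_objects A (Suc i). Src A i \<phi> = a \<and> Tgt A i \<phi> = a' \<and>
              (\<exists>\<beta>. cell_iso B (Suc i) \<beta> (F \<phi>) \<psi>)))) \<and>
     (\<forall>i a a'. parallel_cells A i a a' \<longrightarrow>
        cells_isomorphic B i (F a) (F a') \<longrightarrow> cells_isomorphic A i a a')"


section \<open>Picard \<open>\<omega>\<close>-categories and their homotopy category\<close>

definition omega_prod :: "'a omega_cat \<Rightarrow> 'b omega_cat \<Rightarrow> ('a \<times> 'b) omega_cat" where
  "omega_prod A B =
     \<lparr> Cells = Cells A \<times> Cells B,
       Src = (\<lambda>i (a, b). (Src A i a, Src B i b)),
       Tgt = (\<lambda>i (a, b). (Tgt A i a, Tgt B i b)),
       Cmp = (\<lambda>i (a, b) (a', b'). (Cmp A i a a', Cmp B i b b')) \<rparr>"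

definition omega_terminal :: "unit omega_cat" where
  "omega_terminal = \<lparr> Cells = {()}, Src = (\<lambda>i a. a), Tgt = (\<lambda>i a. a), Cmp = (\<lambda>i a b. a) \<rparr>"

record 'u picard =
  ocat :: "'u omega_cat"
  pgrp :: "'u monoid"

text \<open>An abelian group object: the multiplication, unit and inverse are functors, and the
  commutativity of the diagrams for an abelian group object means that they make the set of cells
  an abelian group.\<close>

definition picard_category :: "'u picard \<Rightarrow> bool" where
  "picard_category A \<longleftrightarrow>
     omega_category (ocat A) \<and>
     comm_group (pgrp A) \<and> carrier (pgrp A) = Cells (ocat A) \<and>
     omega_functor (omega_prod (ocat A) (ocat A)) (ocat A) (\<lambda>(a, b). a \<otimes>\<^bsub>pgrp A\<^esub> b) \<and>
     omega_functor omega_terminal (ocat A) (\<lambda>_. \<one>\<^bsub>pgrp A\<^esub>) \<and>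
     omega_functor (ocat A) (ocat A) (\<lambda>a. inv\<^bsub>pgrp A\<^esub> a)"

definition additive_functor :: "'u picard \<Rightarrow> 'u picard \<Rightarrow> ('u \<Rightarrow> 'u) \<Rightarrow> bool" where
  "additive_functor A B F \<longleftrightarrow>
     omega_functor (ocat A) (ocat B) F \<and> F \<in> hom (pgrp A) (pgrp B) \<and>
     F \<in> extensional (Cells (ocat A))"

type_synonym 'u picard_arrow = "'u picard \<times> ('u \<Rightarrow> 'u) \<times> 'u picard"

definition small_picards :: "'u set set \<Rightarrow> 'u picard set" where
  "small_picards U = {A. picard_category A \<and> Cells (ocat A) \<in> U}"

definition Pic_omega :: "'u set set \<Rightarrow> ('u picard, 'u picard_arrow) cat" where
  "Pic_omega U =
     \<lparr> Obj = small_picards U,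
       Arr = {(A, F, B). A \<in> small_picards U \<and> B \<in> small_picards U \<and> additive_functor A B F},
       Dom = (\<lambda>(A, F, B). A),
       Cod = (\<lambda>(A, F, B). B),
       Ident = (\<lambda>A. (A, restrict (\<lambda>x. x) (Cells (ocat A)), A)),
       Comp = (\<lambda>(B, G, E) (A, F, B'). (A, compose (Cells (ocat A)) G F, E)) \<rparr>"

definition Ho_Pic_omega ::
    "'u set set \<Rightarrow>
       ('u picard, 'u picard \<times> 'u picard_arrow letter list set \<times> 'u picard) cat" where
  "Ho_Pic_omega U = localization (Pic_omega U)
     {(A, F, B). (A, F, B) \<in> Arr (Pic_omega U) \<and> omega_equivalence (ocat A) (ocat B) F}"

end

(*
  The composition of an abelian group object in omega-categories is forced by the group structure:
  a *_i b = a - s_i a + b. A Picard omega-category is therefore an abelian group with endomorphisms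
  s_i, t_i satisfying the globular identities. Its normalized complex has as n-chains the n-objects a
  with s_m a = 0 for all m < n, and t_n as differential; since every cell is the sum of its
  components s_n a - s_(n-1) a, normalization is fully faithful. It is essentially surjective because
  a complex C is recovered from the globular structure on the direct sum of the C_n, whose elements
  are finitely supported sequences and hence can be coded by a small set. Two parallel i-objects
  are isomorphic iff their difference is a boundary, so that a functor is an equivalence of
  omega-categories iff its normalization induces bijections on homology. An equivalence of categories
  which matches the two classes of weak equivalences passes to the localizations.
*)

theory Submission
  imports Defs
begin

section \<open>Localizing an equivalence of categories\<close>

text \<open>Two features make the comparison of weak equivalences exact. The isomorphisms allowed
  between cells are strict, but in an abelian group object every (i+1)-object \<open>u\<close> from
  \<open>a\<close> to \<open>a'\<close> is strictly invertible, with inverse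
  \<open>a + a' - u\<close>; being isomorphic thus means being joined by a cell, and the definition
  of equivalence turns into one about cycles and boundaries. And normalization is an equivalence
  before anything is inverted: complexes are recovered up to isomorphism in \<open>Ch U\<close>, so
  localizations enter only through a general transport result.

  The obstacle is size and type. Cells and chains have the same element type, whereas the direct sum
  of the chain groups consists of sequences; it is moved back by an injection \<open>e\<close> that
  depends on the complex and is not natural in it. Hence no functor from complexes to Picard
  categories is written down: full faithfulness supplies its action on arrows by conjugation with
  chosen isomorphisms. That the code is small rests on countable unions and on
  \<open>A \<times> A\<close> embedding in an infinite \<open>A\<close>, never on power
  sets.\<close>

definition in_hom :: "('o, 'm) cat \<Rightarrow> 'o \<Rightarrow> 'm \<Rightarrow> 'o \<Rightarrow> bool" where
  "in_hom C X f Y \<longleftrightarrow> f \<in> Arr C \<and> Dom C f = X \<and> Cod C f = Y"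

lemma in_hom_self: "f \<in> Arr C \<Longrightarrow> in_hom C (Dom C f) f (Cod C f)"
  by (simp add: in_hom_def)

lemma in_homD:
  assumes "in_hom C X f Y"
  shows "f \<in> Arr C" "Dom C f = X" "Cod C f = Y"
  using assms by (simp_all add: in_hom_def)

lemma in_hom_Obj:
  assumes "category C" "in_hom C X f Y"
  shows "X \<in> Obj C" "Y \<in> Obj C"
  using assms by (auto simp: category_def in_hom_def)

lemma in_hom_Ident:
  assumes "category C" "X \<in> Obj C"
  shows "in_hom C X (Ident C X) X"
  using assms by (simp add: category_def in_hom_def)

lemma in_hom_Comp:
  assumes "category C" "in_hom C X f Y" "in_hom C Y g Z"
  shows "in_hom C X (Comp C g f) Z"
  using assms by (simp add: category_def in_hom_def)

lemma Comp_Ident: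
  assumes "category C" "in_hom C X f Y"
  shows "Comp C f (Ident C X) = f" "Comp C (Ident C Y) f = f"
  using assms category_identD[OF assms(1), of f] by (auto simp: in_hom_def)

lemma Comp_assoc:
  assumes "category C" "in_hom C W f X" "in_hom C X g Y" "in_hom C Y h Z"
  shows "Comp C (Comp C h g) f = Comp C h (Comp C g f)"
  using assms category_assocD[OF assms(1), of f g h] by (auto simp: in_hom_def)

lemma functor_in_hom:
  assumes "is_functor C D Fo Fm" "in_hom C X f Y"
  shows "in_hom D (Fo X) (Fm f) (Fo Y)"
  using assms by (auto simp: is_functor_def in_hom_def)

lemma functor_Comp:
  assumes "is_functor C D Fo Fm" "in_hom C X f Y" "in_hom C Y g Z"
  shows "Fm (Comp C g f) = Comp D (Fm g) (Fm f)"
  using assms by (auto simp: is_functor_def in_hom_def)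

text \<open>Keeping the inverse as an argument lets functors carry it along and lets it be named in
  calculations; \<open>iso_arrow\<close> hides it behind an existential.\<close>

definition inverse_arrows :: "('o, 'm) cat \<Rightarrow> 'o \<Rightarrow> 'm \<Rightarrow> 'm \<Rightarrow> 'o \<Rightarrow> bool" where
  "inverse_arrows C X f g Y \<longleftrightarrow> in_hom C X f Y \<and> in_hom C Y g X \<and>
     Comp C g f = Ident C X \<and> Comp C f g = Ident C Y"

lemma inverse_arrows_sym: "inverse_arrows C X f g Y \<Longrightarrow> inverse_arrows C Y g f X"
  by (auto simp: inverse_arrows_def)

lemma inverse_arrows_cancel:
  assumes "category C" "inverse_arrows C X f g Y"
  shows "in_hom C Z h X \<Longrightarrow> Comp C g (Comp C f h) = h"
    and "in_hom C Y k Z \<Longrightarrow> Comp C (Comp C k f) g = k"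
proof -
  have f: "in_hom C X f Y" and g: "in_hom C Y g X"
    and gf: "Comp C g f = Ident C X" and fg: "Comp C f g = Ident C Y"
    using assms(2) by (auto simp: inverse_arrows_def)
  show "Comp C g (Comp C f h) = h" if "in_hom C Z h X"
    using Comp_assoc[OF assms(1) that f g] gf Comp_Ident(2)[OF assms(1) that] by simp
  show "Comp C (Comp C k f) g = k" if "in_hom C Y k Z"
    using Comp_assoc[OF assms(1) g f that] fg Comp_Ident(1)[OF assms(1) that] by simp
qed

lemma iso_arrow_iff:
  "iso_arrow C f \<and> Dom C f = X \<and> Cod C f = Y \<longleftrightarrow> (\<exists>g. inverse_arrows C X f g Y)"
  by (auto simp: iso_arrow_def inverse_arrows_def in_hom_def)

lemma functor_inverse_arrows:
  assumes "category C" "is_functor C D Fo Fm" "inverse_arrows C X f g Y"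
  shows "inverse_arrows D (Fo X) (Fm f) (Fm g) (Fo Y)"
proof -
  have f: "in_hom C X f Y" and g: "in_hom C Y g X"
    and e: "Comp C g f = Ident C X" "Comp C f g = Ident C Y"
    using assms(3) by (auto simp: inverse_arrows_def)
  show ?thesis
    using functor_in_hom[OF assms(2) f] functor_in_hom[OF assms(2) g]
      functor_Comp[OF assms(2) f g] functor_Comp[OF assms(2) g f]
      functor_identD[OF assms(2)] in_hom_Obj[OF assms(1) f] e
    by (simp add: inverse_arrows_def)
qed

lemma is_functor_comp:
  assumes "is_functor C D Fo Fm" "is_functor D E Go Gm"
  shows "is_functor C E (\<lambda>X. Go (Fo X)) (\<lambda>f. Gm (Fm f))"
  using assms by (auto simp: is_functor_def)

section \<open>Arrows and naturality in a localization\<close>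

lemma localize_in_hom:
  assumes "category C" "in_hom C X f Y"
  shows "in_hom (localization C W) X (localize C W f) Y"
  using functor_in_hom[OF localize_functor[OF assms(1)] assms(2)] .

text \<open>A zigzag is a composite of images \<open>localize C W f\<close> and formal inverses, so
  a property closed under composition has to be checked only on these. The formal inverse of
  \<open>w\<close> is a two-sided inverse of \<open>localize C W w\<close>; stating case
  \<open>inv\<close> for arbitrary inverse pairs keeps zigzags out of later arguments.\<close>

lemma localization_arr_induct [consumes 2, case_names ident gen inv comp]:
  assumes C: "category C" and a: "in_hom (localization C W) X a Y"
    and ident: "\<And>X. X \<in> Obj C \<Longrightarrow> P X (Ident (localization C W) X) X"
    and gen: "\<And>X f Y. in_hom C X f Y \<Longrightarrow> P X (localize C W f) Y"
    and inv: "\<And>X w Y v. inverse_arrows (localization C W) X w v Y \<Longrightarrow> P X w Y \<Longrightarrow> P Y v X"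
    and comp: "\<And>X f Y g Z. in_hom (localization C W) X f Y \<Longrightarrow> in_hom (localization C W) Y g Z
        \<Longrightarrow> P X f Y \<Longrightarrow> P Y g Z \<Longrightarrow> P X (Comp (localization C W) g f) Z"
  shows "P X a Y"
proof -
  let ?L = "localization C W"
  have zz: "in_hom ?L X (zz_arrow C W X p Y) Y" if "zigzag C W X p Y" for X p Y
    using that by (auto simp: in_hom_def localization_simps)
  have "P X (zz_arrow C W X p Y) Y" if "zigzag C W X p Y" for X p Y
    using that
  proof induction
    case (nil X)
    then show ?case using ident[of X] by (simp add: localization_simps)
  next
    case (fwd f p Y)
    note z = zigzag_single[OF C fwd(1), of W]
    have "zz_arrow C W (Dom C f) (Fwd f # p) Y
        = Comp ?L (zz_arrow C W (Cod C f) p Y) (localize C W f)"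
      using localization_comp[OF C z fwd(2)] by (simp add: localize_def)
    then show ?case
      using comp[OF localize_in_hom[OF C in_hom_self[OF fwd(1)]] zz[OF fwd(2)]
          gen[OF in_hom_self[OF fwd(1)]] fwd(3)] by simp
  next
    case (bwd w p Y)
    let ?b = "zz_arrow C W (Cod C w) [Bwd w] (Dom C w)" and ?f = "localize C W w"
    note z = zigzag_single_bwd[OF C bwd(1,2)] and zf = zigzag_single[OF C bwd(1), of W]
    have ob: "Dom C w \<in> Obj C" "Cod C w \<in> Obj C" using C bwd(1) by (auto simp: category_def)
    have e: "zz_arrow C W (Cod C w) (Bwd w # p) Y = Comp ?L (zz_arrow C W (Dom C w) p Y) ?b"
      using localization_comp[OF C z bwd(3)] by simp
    have "inverse_arrows ?L (Dom C w) ?f ?b (Cod C w)"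
      using localization_comp[OF C zf z] localization_comp[OF C z zf] zz[OF z] zz[OF zf]
        zz_arrow_eq_iff[OF zigzag.nil[OF ob(1)]] zz_arrow_eq_iff[OF zigzag.nil[OF ob(2)]]
        zz_eq.cancel_left[OF bwd(1,2)] zz_eq.cancel_right[OF bwd(1,2)]
      by (simp add: inverse_arrows_def localize_def localization_simps) metis
    then have "P (Cod C w) ?b (Dom C w)"
      using inv gen[OF in_hom_self[OF bwd(1)]] by blast
    then show ?case
      using comp[OF zz[OF z] zz[OF bwd(3)] _ bwd(4)] e by simp
  qed
  then show ?thesis using a by (auto simp: in_hom_def localization_simps)
qed

text \<open>Squares paste along composites, and a commuting square at an invertible arrow yields the
  one at its inverse; hence naturality on arrows coming from \<open>C\<close> extends to formal
  inverses. The components are indexed by the objects of \<open>C\<close>, which localizing does not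
  change.\<close>

lemma localization_natural:
  assumes C: "category C" and D: "category D"
    and P: "is_functor (localization C W) D Po Pm"
    and Q: "is_functor (localization C W) D Qo Qm"
    and \<eta>: "\<And>X. X \<in> Obj C \<Longrightarrow> in_hom D (Po X) (\<eta> X) (Qo X)"
    and nat: "\<And>X f Y. in_hom C X f Y \<Longrightarrow>
        Comp D (\<eta> Y) (Pm (localize C W f)) = Comp D (Qm (localize C W f)) (\<eta> X)"
    and a: "in_hom (localization C W) X a Y"
  shows "Comp D (\<eta> Y) (Pm a) = Comp D (Qm a) (\<eta> X)"
  using C a
proof (induction rule: localization_arr_induct)
  case (ident X)
  then show ?case
    using functor_identD[OF P] functor_identD[OF Q] Comp_Ident[OF D \<eta>[OF ident]]
    by (simp add: localization_simps)
next
  case (gen X f Y)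
  then show ?case by (rule nat)
next
  case (inv X w Y v)
  let ?L = "localization C W"
  note L = category_localization[OF C, of W]
  have wv: "in_hom ?L X w Y" "in_hom ?L Y v X" using inv by (auto simp: inverse_arrows_def)
  have X: "X \<in> Obj C" and Y: "Y \<in> Obj C"
    using in_hom_Obj[OF L wv(1)] by (simp_all add: localization_simps)
  note Pi = functor_inverse_arrows[OF L P inv(1)]
  note Qi = functor_inverse_arrows[OF L Q inv(1)]
  note h = functor_in_hom[OF P wv(1)] functor_in_hom[OF P wv(2)]
    functor_in_hom[OF Q wv(1)] functor_in_hom[OF Q wv(2)]
  \<comment> \<open>Write \<open>\<eta> Y\<close> as \<open>\<eta> Y\<close> after
    \<open>Pm w\<close> after \<open>Pm v\<close>, move the square at \<open>w\<close> across, and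
    cancel \<open>Qm v\<close> against \<open>Qm w\<close>.\<close>
  have "Comp D (Qm v) (\<eta> Y) = Comp D (Qm v) (Comp D (Comp D (\<eta> Y) (Pm w)) (Pm v))"
    using inverse_arrows_cancel(2)[OF D Pi \<eta>[OF Y]] by simp
  also have "\<dots> = Comp D (Qm v) (Comp D (Qm w) (Comp D (\<eta> X) (Pm v)))"
    using Comp_assoc[OF D h(2) \<eta>[OF X] h(3)] inv(2) by simp
  also have "\<dots> = Comp D (\<eta> X) (Pm v)"
    using inverse_arrows_cancel(1)[OF D Qi in_hom_Comp[OF D h(2) \<eta>[OF X]]] .
  finally show ?case by simp
next
  case (comp X f Y g Z)
  note L = category_localization[OF C, of W]
  have X: "X \<in> Obj C" and Y: "Y \<in> Obj C" and Z: "Z \<in> Obj C"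
    using in_hom_Obj[OF L comp(1)] in_hom_Obj[OF L comp(2)] by (simp_all add: localization_simps)
  note p = functor_in_hom[OF P comp(1)] functor_in_hom[OF P comp(2)]
  note q = functor_in_hom[OF Q comp(1)] functor_in_hom[OF Q comp(2)]
  have "Comp D (\<eta> Z) (Pm (Comp (localization C W) g f)) = Comp D (Comp D (\<eta> Z) (Pm g)) (Pm f)"
    using functor_Comp[OF P comp(1,2)] Comp_assoc[OF D p \<eta>[OF Z]] by simp
  also have "\<dots> = Comp D (Qm g) (Comp D (\<eta> Y) (Pm f))"
    using comp(4) Comp_assoc[OF D p(1) \<eta>[OF Y] q(2)] by simp
  also have "\<dots> = Comp D (Comp D (Qm g) (Qm f)) (\<eta> X)"
    using comp(3) Comp_assoc[OF D \<eta>[OF X] q] by simp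
  also have "\<dots> = Comp D (Qm (Comp (localization C W) g f)) (\<eta> X)"
    using functor_Comp[OF Q comp(1,2)] by simp
  finally show ?case .
qed

lemma natural_isoI:
  assumes "\<And>X. X \<in> Obj C \<Longrightarrow> inverse_arrows D (Fo X) (\<eta> X) (\<theta> X) (Go X)"
    and "\<And>X f Y. in_hom C X f Y \<Longrightarrow> Comp D (\<eta> Y) (Fm f) = Comp D (Gm f) (\<eta> X)"
  shows "natural_iso C D Fo Fm Go Gm \<eta>"
  using assms in_hom_self[of _ C] iso_arrow_iff[of D] unfolding natural_iso_def by metis

text \<open>Each functor followed by localization inverts the given class, so the universal property
  extends it. The unit and counit are localized componentwise and stay invertible because functors
  preserve inverse pairs.\<close>

lemma equivalent_localizations:
  assumes C: "category C" and D: "category D"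
    and F: "is_functor C D Fo Fm" and G: "is_functor D C Go Gm"
    and FW: "\<And>f. f \<in> Arr C \<Longrightarrow> f \<in> W \<Longrightarrow> Fm f \<in> V"
    and GV: "\<And>f. f \<in> Arr D \<Longrightarrow> f \<in> V \<Longrightarrow> Gm f \<in> W"
    and \<eta>: "\<And>X. X \<in> Obj C \<Longrightarrow> inverse_arrows C X (\<eta> X) (\<eta>' X) (Go (Fo X))"
    and \<eta>_nat: "\<And>X f Y. in_hom C X f Y \<Longrightarrow> Comp C (\<eta> Y) f = Comp C (Gm (Fm f)) (\<eta> X)"
    and \<epsilon>: "\<And>Y. Y \<in> Obj D \<Longrightarrow> inverse_arrows D (Fo (Go Y)) (\<epsilon> Y) (\<epsilon>' Y) Y"
    and \<epsilon>_nat: "\<And>X f Y. in_hom D X f Y \<Longrightarrow> Comp D (\<epsilon> Y) (Fm (Gm f)) = Comp D f (\<epsilon> X)"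
  shows "equivalent_categories (localization C W) (localization D V)"
proof -
  let ?LC = "localization C W" and ?LD = "localization D V"
  note LC = category_localization[OF C, of W] and LD = category_localization[OF D, of V]
  note lC = localize_functor[OF C, of W] and lD = localize_functor[OF D, of V]
  have wK: "iso_arrow ?LD (localize D V (Fm w))" if "w \<in> W" "w \<in> Arr C" for w
    using localize_inverts[OF D] FW that F by (auto simp: is_functor_def)
  obtain Km where K: "is_functor ?LC ?LD Fo Km"
      and Kl: "\<And>f. f \<in> Arr C \<Longrightarrow> Km (localize C W f) = localize D V (Fm f)"
    using localization_universal_existence[OF C LD is_functor_comp[OF F lD] wK] by metis
  have wH: "iso_arrow ?LC (localize C W (Gm w))" if "w \<in> V" "w \<in> Arr D" for w
    using localize_inverts[OF C] GV that G by (auto simp: is_functor_def)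
  obtain Hm where H: "is_functor ?LD ?LC Go Hm"
      and Hl: "\<And>f. f \<in> Arr D \<Longrightarrow> Hm (localize D V f) = localize C W (Gm f)"
    using localization_universal_existence[OF D LC is_functor_comp[OF G lC] wH] by metis
  have id: "is_functor E E (\<lambda>X. X) (\<lambda>f. f)" for E :: "('x, 'y) cat"
    by (simp add: is_functor_def)
  show ?thesis
    unfolding equivalent_categories_def
  proof (intro conjI exI)
    show "is_functor ?LC ?LD Fo Km" "is_functor ?LD ?LC Go Hm" by fact+
    show "natural_iso ?LC ?LC (\<lambda>X. X) (\<lambda>f. f) (\<lambda>X. Go (Fo X)) (\<lambda>f. Hm (Km f)) (\<lambda>X. localize C W (\<eta> X))"
    proof (rule natural_isoI)
      show inv: "inverse_arrows ?LC X (localize C W (\<eta> X)) (localize C W (\<eta>' X)) (Go (Fo X))"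
        if "X \<in> Obj ?LC" for X
        using functor_inverse_arrows[OF C lC \<eta>] that by (simp add: localization_simps)
      show "Comp ?LC (localize C W (\<eta> Y)) f = Comp ?LC (Hm (Km f)) (localize C W (\<eta> X))"
        if f: "in_hom ?LC X f Y" for X f Y
      proof (rule localization_natural[OF C LC id is_functor_comp[OF K H] _ _ f])
        show "in_hom ?LC X (localize C W (\<eta> X)) (Go (Fo X))" if "X \<in> Obj C" for X
          using inv that by (simp add: localization_simps inverse_arrows_def)
        show "Comp ?LC (localize C W (\<eta> Y)) (localize C W f)
            = Comp ?LC (Hm (Km (localize C W f))) (localize C W (\<eta> X))"
          if f: "in_hom C X f Y" for X f Y
        proof -
          have e: "in_hom C Z (\<eta> Z) (Go (Fo Z))" if "Z \<in> Obj C" for Z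
            using \<eta>[OF that] by (simp add: inverse_arrows_def)
          note F1 = functor_in_hom[OF F f]
          have "Hm (Km (localize C W f)) = localize C W (Gm (Fm f))"
            using Kl[of f] Hl[of "Fm f"] in_homD(1)[OF f] in_homD(1)[OF F1] by simp
          then show ?thesis
            using functor_Comp[OF lC f e] functor_Comp[OF lC e functor_in_hom[OF G F1]]
              in_hom_Obj[OF C f] \<eta>_nat[OF f] by simp
        qed
      qed
    qed
    show "natural_iso ?LD ?LD (\<lambda>Y. Fo (Go Y)) (\<lambda>g. Km (Hm g)) (\<lambda>Y. Y) (\<lambda>g. g) (\<lambda>X. localize D V (\<epsilon> X))"
    proof (rule natural_isoI)
      show inv: "inverse_arrows ?LD (Fo (Go Y)) (localize D V (\<epsilon> Y)) (localize D V (\<epsilon>' Y)) Y"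
        if "Y \<in> Obj ?LD" for Y
        using functor_inverse_arrows[OF D lD \<epsilon>] that by (simp add: localization_simps)
      show "Comp ?LD (localize D V (\<epsilon> Y)) (Km (Hm f)) = Comp ?LD f (localize D V (\<epsilon> X))"
        if f: "in_hom ?LD X f Y" for X f Y
      proof (rule localization_natural[OF D LD is_functor_comp[OF H K] id _ _ f])
        show "in_hom ?LD (Fo (Go Y)) (localize D V (\<epsilon> Y)) Y" if "Y \<in> Obj D" for Y
          using inv that by (simp add: localization_simps inverse_arrows_def)
        show "Comp ?LD (localize D V (\<epsilon> Y)) (Km (Hm (localize D V f)))
            = Comp ?LD (localize D V f) (localize D V (\<epsilon> X))"
          if f: "in_hom D X f Y" for X f Y
        proof -
          have e: "in_hom D (Fo (Go Z)) (\<epsilon> Z) Z" if "Z \<in> Obj D" for Z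
            using \<epsilon>[OF that] by (simp add: inverse_arrows_def)
          note G1 = functor_in_hom[OF G f]
          have "Km (Hm (localize D V f)) = localize D V (Fm (Gm f))"
            using Hl[of f] Kl[of "Gm f"] in_homD(1)[OF f] in_homD(1)[OF G1] by simp
          then show ?thesis
            using functor_Comp[OF lD e f] functor_Comp[OF lD functor_in_hom[OF F G1] e]
              in_hom_Obj[OF D f] \<epsilon>_nat[OF f] by simp
        qed
      qed
    qed
  qed (fact LC LD)+
qed

text \<open>The quasi-inverse is transported along chosen isomorphisms \<open>No (Go Y) \<cong> Y\<close>.\<close>

lemma equivalent_localizations_ff_es:
  assumes C: "category C" and D: "category D"
    and N: "is_functor C D No Nm"
    and full: "\<And>X Y g. X \<in> Obj C \<Longrightarrow> Y \<in> Obj C \<Longrightarrow> in_hom D (No X) g (No Y) \<Longrightarrow>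
        \<exists>f. in_hom C X f Y \<and> Nm f = g"
    and faithful: "\<And>X Y f f'. in_hom C X f Y \<Longrightarrow> in_hom C X f' Y \<Longrightarrow> Nm f = Nm f' \<Longrightarrow> f = f'"
    and es: "\<And>Y. Y \<in> Obj D \<Longrightarrow> \<exists>X\<in>Obj C. \<exists>e e'. inverse_arrows D (No X) e e' Y"
    and WV: "\<And>f. f \<in> Arr C \<Longrightarrow> f \<in> W \<longleftrightarrow> Nm f \<in> V"
    and V_iso: "\<And>X e e' Y. inverse_arrows D X e e' Y \<Longrightarrow> e \<in> V"
    and V_comp: "\<And>X f Y g Z. in_hom D X f Y \<Longrightarrow> in_hom D Y g Z \<Longrightarrow> f \<in> V \<Longrightarrow> g \<in> V \<Longrightarrow>
        Comp D g f \<in> V"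
  shows "equivalent_categories (localization D V) (localization C W)"
proof -
  from es obtain Go e e' where Go: "\<And>Y. Y \<in> Obj D \<Longrightarrow> Go Y \<in> Obj C"
      and e: "\<And>Y. Y \<in> Obj D \<Longrightarrow> inverse_arrows D (No (Go Y)) (e Y) (e' Y) Y"
    by metis
  note eh = e[unfolded inverse_arrows_def, THEN conjunct1]
  note eh' = e[unfolded inverse_arrows_def, THEN conjunct2, THEN conjunct1]
  have e'e: "Comp D (e' Y) (e Y) = Ident D (No (Go Y))" "Comp D (e Y) (e' Y) = Ident D Y"
    if "Y \<in> Obj D" for Y
    using e[OF that] by (auto simp: inverse_arrows_def)
  have NOb: "No X \<in> Obj D" if "X \<in> Obj C" for X using N that by (simp add: is_functor_def)
  \<comment> \<open>Fullness of \<open>No\<close> applies only to arrows between objects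
    \<open>No X\<close>, so \<open>g\<close> is moved there along \<open>e\<close> and
    \<open>e'\<close>; \<open>Gm g\<close> will be a preimage of the result.\<close>
  define conj where "conj g = Comp D (e' (Cod D g)) (Comp D g (e (Dom D g)))" for g
  have conj: "in_hom D (No (Go X)) (conj g) (No (Go Y))" "conj g = Comp D (e' Y) (Comp D g (e X))"
    if "in_hom D X g Y" for X g Y
    using in_hom_Comp[OF D in_hom_Comp[OF D eh that] eh'] in_hom_Obj[OF D that] in_homD[OF that]
    by (simp_all add: conj_def)
  have "\<exists>f. in_hom C (Go (Dom D g)) f (Go (Cod D g)) \<and> Nm f = conj g" if "g \<in> Arr D" for g
    using full[OF _ _ conj(1)[OF in_hom_self[OF that]]] Go in_hom_Obj[OF D in_hom_self[OF that]]
    by blast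
  then obtain Gm where Gm: "\<And>g. g \<in> Arr D \<Longrightarrow> in_hom C (Go (Dom D g)) (Gm g) (Go (Cod D g))"
      and NG: "\<And>g. g \<in> Arr D \<Longrightarrow> Nm (Gm g) = conj g"
    by metis
  have Gh: "in_hom C (Go X) (Gm g) (Go Y)" if "in_hom D X g Y" for X g Y
    using Gm[of g] in_homD[OF that] by simp
  have NG_nat: "Comp D (e Y) (Nm (Gm g)) = Comp D g (e X)" if g: "in_hom D X g Y" for X g Y
    using inverse_arrows_cancel(1)[OF D inverse_arrows_sym[OF e]
        in_hom_Comp[OF D eh g]] NG[of g] conj(2)[OF g] in_homD[OF g] in_hom_Obj[OF D g] by simp
  have NG_nat': "Comp D (e' Y) g = Comp D (Nm (Gm g)) (e' X)" if g: "in_hom D X g Y" for X g Y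
  proof -
    have X: "X \<in> Obj D" and Y: "Y \<in> Obj D" using in_hom_Obj[OF D g] by auto
    have "Comp D (Nm (Gm g)) (e' X) = Comp D (Comp D (e' Y) (Comp D g (e X))) (e' X)"
      using NG[of g] conj(2)[OF g] in_homD[OF g] by simp
    also have "\<dots> = Comp D (e' Y) (Comp D (Comp D g (e X)) (e' X))"
      using Comp_assoc[OF D eh'[OF X] in_hom_Comp[OF D eh[OF X] g] eh'[OF Y]] .
    also have "\<dots> = Comp D (e' Y) g"
      using inverse_arrows_cancel(2)[OF D e[OF X] g] by simp
    finally show ?thesis by simp
  qed
  have G: "is_functor D C Go Gm"
    unfolding is_functor_def
  proof (intro conjI ballI impI)
    fix Y assume Y: "Y \<in> Obj D"
    show "Gm (Ident D Y) = Ident C (Go Y)"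
    proof (rule faithful)
      note i = in_hom_Ident[OF D Y]
      show "in_hom C (Go Y) (Gm (Ident D Y)) (Go Y)" using Gh[OF i] .
      show "in_hom C (Go Y) (Ident C (Go Y)) (Go Y)" using in_hom_Ident[OF C Go[OF Y]] .
      show "Nm (Gm (Ident D Y)) = Nm (Ident C (Go Y))"
        using NG[OF in_homD(1)[OF i]] conj(2)[OF i] Comp_Ident[OF D eh[OF Y]] e'e[OF Y]
          functor_identD[OF N Go[OF Y]] by simp
    qed
  next
    fix f g assume "f \<in> Arr D" "g \<in> Arr D" "Dom D g = Cod D f"
    then obtain X Y Z where f: "in_hom D X f Y" and g: "in_hom D Y g Z"
      by (auto simp: in_hom_def)
    have X: "X \<in> Obj D" and Y: "Y \<in> Obj D" and Z: "Z \<in> Obj D"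
      using in_hom_Obj[OF D f] in_hom_Obj[OF D g] by auto
    note gf = in_hom_Comp[OF D f g]
    show "Gm (Comp D g f) = Comp C (Gm g) (Gm f)"
    proof (rule faithful)
      show "in_hom C (Go X) (Gm (Comp D g f)) (Go Z)" using Gh[OF gf] .
      show "in_hom C (Go X) (Comp C (Gm g) (Gm f)) (Go Z)"
        using in_hom_Comp[OF C Gh[OF f] Gh[OF g]] .
      have "Nm (Comp C (Gm g) (Gm f)) = Comp D (Comp D (e' Z) (Comp D g (e Y))) (Nm (Gm f))"
        using functor_Comp[OF N Gh[OF f] Gh[OF g]] NG[OF in_homD(1)[OF g]] conj(2)[OF g] by simp
      also have "\<dots> = Comp D (e' Z) (Comp D g (Comp D (e Y) (Nm (Gm f))))"
        using Comp_assoc[OF D functor_in_hom[OF N Gh[OF f]] in_hom_Comp[OF D eh[OF Y] g] eh'[OF Z]]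
          Comp_assoc[OF D functor_in_hom[OF N Gh[OF f]] eh[OF Y] g] by simp
      also have "\<dots> = Comp D (e' Z) (Comp D (Comp D g f) (e X))"
        using NG_nat[OF f] Comp_assoc[OF D eh[OF X] f g] by simp
      also have "\<dots> = Nm (Gm (Comp D g f))"
        using NG[OF in_homD(1)[OF gf]] conj(2)[OF gf] by simp
      finally show "Nm (Gm (Comp D g f)) = Nm (Comp C (Gm g) (Gm f))" by simp
    qed
  qed (use Go Gm in \<open>auto simp: in_hom_def\<close>)
  \<comment> \<open>A fully faithful functor reflects isomorphisms: preimages of
    \<open>e (No X)\<close> and \<open>e' (No X)\<close> are mutually inverse and give the second
    natural isomorphism.\<close>
  have "\<exists>k k'. inverse_arrows C (Go (No X)) k k' X \<and> Nm k = e (No X)" if X: "X \<in> Obj C" for X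
  proof -
    note G1 = Go[OF NOb[OF X]]
    obtain k where k: "in_hom C (Go (No X)) k X" "Nm k = e (No X)"
      using full[OF G1 X eh[OF NOb[OF X]]] by auto
    obtain k' where k': "in_hom C X k' (Go (No X))" "Nm k' = e' (No X)"
      using full[OF X G1 eh'[OF NOb[OF X]]] by auto
    have "Comp C k' k = Ident C (Go (No X))"
      using faithful[OF in_hom_Comp[OF C k(1) k'(1)] in_hom_Ident[OF C G1]]
        functor_Comp[OF N k(1) k'(1)] functor_identD[OF N G1] k(2) k'(2) e'e NOb[OF X] by simp
    moreover have "Comp C k k' = Ident C X"
      using faithful[OF in_hom_Comp[OF C k'(1) k(1)] in_hom_Ident[OF C X]]
        functor_Comp[OF N k'(1) k(1)] functor_identD[OF N X] k(2) k'(2) e'e NOb[OF X] by simp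
    ultimately show ?thesis using k k' by (auto simp: inverse_arrows_def)
  qed
  then obtain k k' where k: "\<And>X. X \<in> Obj C \<Longrightarrow> inverse_arrows C (Go (No X)) (k X) (k' X) X"
      and Nk: "\<And>X. X \<in> Obj C \<Longrightarrow> Nm (k X) = e (No X)"
    by metis
  note kh = k[unfolded inverse_arrows_def, THEN conjunct1]
  show ?thesis
  \<comment> \<open>Read from \<open>D\<close>, the quasi-inverse comes first: \<open>e'\<close>
    goes from \<open>Y\<close> to \<open>No (Go Y)\<close> and is the unit, while \<open>k\<close>
    goes from \<open>Go (No X)\<close> to \<open>X\<close> and is the counit.\<close>
  proof (rule equivalent_localizations[OF D C G N, where \<eta>=e' and \<eta>'=e and \<epsilon>=k and \<epsilon>'=k'])
    show "Gm f \<in> W" if "f \<in> Arr D" "f \<in> V" for f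
    proof -
      obtain X Y where f: "in_hom D X f Y" using in_hom_self[OF \<open>f \<in> Arr D\<close>] by blast
      have X: "X \<in> Obj D" and Y: "Y \<in> Obj D" using in_hom_Obj[OF D f] by auto
      \<comment> \<open>Here \<open>V\<close> has to contain the isomorphisms and be closed under
        composition: \<open>conj f\<close> differs from \<open>f\<close> by isomorphisms on both
        sides.\<close>
      have "conj f \<in> V"
        using V_comp[OF in_hom_Comp[OF D eh[OF X] f] eh'[OF Y] V_comp[OF eh[OF X] f]]
          V_iso[OF e[OF X]] V_iso[OF inverse_arrows_sym[OF e[OF Y]]] that(2) conj(2)[OF f] by simp
      then show ?thesis
        using WV[OF in_homD(1)[OF Gh[OF f]]] NG[OF that(1)] by simp
    qed
    show "Comp C (k Y) (Gm (Nm f)) = Comp C f (k X)" if f: "in_hom C X f Y" for X f Y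
    proof -
      have X: "X \<in> Obj C" and Y: "Y \<in> Obj C" using in_hom_Obj[OF C f] by auto
      note Nf = functor_in_hom[OF N f]
      show ?thesis
        using faithful[OF in_hom_Comp[OF C Gh[OF Nf] kh[OF Y]] in_hom_Comp[OF C kh[OF X] f]]
          functor_Comp[OF N Gh[OF Nf] kh[OF Y]] functor_Comp[OF N kh[OF X] f]
          Nk[OF X] Nk[OF Y] NG_nat[OF Nf] by simp
    qed
  qed (use WV k NG_nat' inverse_arrows_sym[OF e] in auto)
qed


section \<open>Small sets\<close>

text \<open>\<open>A \<times> A\<close> embeds in the infinite set \<open>A\<close>, so by induction
  the words of each fixed length do, and a union of countably many such sets still does.\<close>

lemma lists_lepoll_infinite:
  assumes "infinite A"
  shows "lists A \<lesssim> A"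
proof -
  have len: "{xs \<in> lists A. length xs = n} \<lesssim> A" for n
  proof (induction n)
    case 0
    obtain a where "a \<in> A" using assms by fastforce
    then show ?case
      by (intro subset_image_lepoll[of _ "\<lambda>_. []"]) auto
  next
    case (Suc n)
    have "{xs \<in> lists A. length xs = Suc n}
        \<subseteq> (\<lambda>(x, xs). x # xs) ` (A \<times> {xs \<in> lists A. length xs = n})"
    proof
      fix xs assume "xs \<in> {xs \<in> lists A. length xs = Suc n}"
      then show "xs \<in> (\<lambda>(x, xs). x # xs) ` (A \<times> {xs \<in> lists A. length xs = n})"
        by (cases xs) auto
    qed
    then have "{xs \<in> lists A. length xs = Suc n} \<lesssim> A \<times> {xs \<in> lists A. length xs = n}"
      by (rule subset_image_lepoll)
    also have "\<dots> \<lesssim> A \<times> A"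
      by (intro times_lepoll_mono lepoll_refl Suc)
    also have "\<dots> \<lesssim> A"
      using card_of_Times_same_infinite[OF assms]
      by (intro eqpoll_imp_lepoll) (simp add: eqpoll_iff_card_of_ordIso)
    finally show ?case .
  qed
  have "(card_of (\<Union>n\<in>UNIV. {xs \<in> lists A. length xs = n}), card_of A) \<in> ordLeq"
    using len assms infinite_iff_card_of_nat[of A]
    by (intro card_of_UNION_ordLeq_infinite) (auto simp: lepoll_def card_of_ordLeq[symmetric])
  moreover have "(\<Union>n\<in>UNIV. {xs \<in> lists A. length xs = n}) = lists A"
    by auto
  ultimately show ?thesis
    by (simp add: lepoll_def card_of_ordLeq[symmetric])
qed

text \<open>With the chain groups for \<open>S\<close> and their units for \<open>z\<close> this is
  the underlying set of the direct sum.\<close>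

definition finite_support :: "(nat \<Rightarrow> 'a set) \<Rightarrow> (nat \<Rightarrow> 'a) \<Rightarrow> (nat \<Rightarrow> 'a) set" where
  "finite_support S z = {c. (\<forall>n. c n \<in> S n) \<and> (\<exists>N. \<forall>n\<ge>N. c n = z n)}"

text \<open>A sequence is determined by the list of its entries before the point where it agrees
  with \<open>z\<close> for good, and lists over an infinite set embed in that set. This re-encodes
  the direct sum in the type of the chains themselves.\<close>

lemma universe_finite_support:
  assumes "universe U" "\<And>n. S n \<in> U"
  obtains e where "inj_on e (finite_support S z)" "e ` finite_support S z \<in> U"
proof -
  obtain I where I: "I \<in> U" "infinite I"
    using assms(1) by (auto simp: universe_def)
  \<comment> \<open>An infinite small set \<open>I\<close> is thrown in because the sets
    \<open>S n\<close> together may be finite, and the list embedding requires an infinite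
    alphabet.\<close>
  define X where "X = (\<Union>n. case n of 0 \<Rightarrow> I | Suc n \<Rightarrow> S n)"
  have "\<forall>n. (case n of 0 \<Rightarrow> I | Suc n \<Rightarrow> S n) \<in> U"
    using I assms(2) by (simp split: nat.split)
  then have XU: "X \<in> U"
    using assms(1) unfolding universe_def X_def by meson
  have "I \<subseteq> X" "S n \<subseteq> X" for n
    unfolding X_def by (auto split: nat.splits intro: exI[of _ 0] exI[of _ "Suc n"])
  then have X: "infinite X" "\<And>n. S n \<subseteq> X"
    using I(2) by (auto dest: finite_subset)
  \<comment> \<open>Taking the least bound makes the list canonical. Its length recovers the bound,
    so equal lists force equality beyond it as well.\<close>
  define N where "N c = (LEAST N. \<forall>n\<ge>N. c n = z n)" for c
  have N: "\<forall>n\<ge>N c. c n = z n" if "c \<in> finite_support S z" for c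
    using that LeastI_ex[of "\<lambda>N. \<forall>n\<ge>N. c n = z n"] unfolding N_def finite_support_def by blast
  let ?l = "\<lambda>c. map c [0..<N c]"
  have "inj_on ?l (finite_support S z)"
  proof (rule inj_onI)
    fix c d assume c: "c \<in> finite_support S z" and d: "d \<in> finite_support S z" and e: "?l c = ?l d"
    have l: "N c = N d" using arg_cong[OF e, of length] by simp
    have "c n = d n" for n
    proof (cases "n < N c")
      case True
      then show ?thesis using arg_cong[OF e, of "\<lambda>xs. xs ! n"] l by simp
    next
      case False
      then show ?thesis using N[OF c] N[OF d] l by simp
    qed
    then show "c = d" ..
  qed
  moreover have "?l ` finite_support S z \<subseteq> lists X"
    using X(2) by (fastforce simp: finite_support_def)
  ultimately have "finite_support S z \<lesssim> lists X"
    unfolding lepoll_def by blast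
  also have "\<dots> \<lesssim> X" using X(1) by (rule lists_lepoll_infinite)
  finally obtain e where e: "inj_on e (finite_support S z)" "e ` finite_support S z \<subseteq> X"
    unfolding lepoll_def by blast
  have "e ` finite_support S z \<in> U"
    using assms(1) XU subset_imp_lepoll[OF e(2)] unfolding universe_def by blast
  with e(1) show thesis by (rule that)
qed

lemma universe_subset:
  assumes "universe U" "X \<in> U" "Y \<subseteq> X"
  shows "Y \<in> U"
  using assms subset_imp_lepoll unfolding universe_def by blast


section \<open>Quasi-isomorphisms\<close>

text \<open>The induced map sends the coset of \<open>z\<close> to the coset of \<open>h z\<close>.
  Its kernel is trivial when \<open>h z \<in> B\<close> forces \<open>z \<in> A\<close>, and
  surjectivity means solving \<open>w = h z\<close> modulo \<open>B\<close>. This trades cosets for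
  elements, the form in which homology meets cells.\<close>

lemma quotient_map_iso_iff:
  assumes "comm_group G" "comm_group H" and A: "subgroup A G" and B: "subgroup B H"
    and h: "h \<in> hom G H" and AB: "h ` A \<subseteq> B"
  shows "(\<lambda>X. B <#>\<^bsub>H\<^esub> (h ` X)) \<in> iso (G Mod A) (H Mod B) \<longleftrightarrow>
    (\<forall>z\<in>carrier G. h z \<in> B \<longrightarrow> z \<in> A) \<and>
    (\<forall>w\<in>carrier H. \<exists>z\<in>carrier G. w \<otimes>\<^bsub>H\<^esub> inv\<^bsub>H\<^esub> h z \<in> B)"
    (is "?\<phi> \<in> _ \<longleftrightarrow> ?inj \<and> ?surj")
proof -
  interpret G: comm_group G by fact
  interpret H: comm_group H by fact
  interpret h: group_hom G H h
    using h by (simp add: group_hom_def group_hom_axioms_def G.is_group H.is_group)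
  interpret A: normal A G using A by (simp add: G.normal_iff_subgroup)
  interpret B: normal B H using B by (simp add: H.normal_iff_subgroup)
  have \<phi>: "?\<phi> (A #>\<^bsub>G\<^esub> z) = B #>\<^bsub>H\<^esub> h z" if z: "z \<in> carrier G" for z
  proof
    show "?\<phi> (A #>\<^bsub>G\<^esub> z) \<subseteq> B #>\<^bsub>H\<^esub> h z"
    proof
      fix x assume "x \<in> ?\<phi> (A #>\<^bsub>G\<^esub> z)"
      then obtain b a where "b \<in> B" "a \<in> A" "x = b \<otimes>\<^bsub>H\<^esub> h (a \<otimes>\<^bsub>G\<^esub> z)"
        by (auto simp: set_mult_def r_coset_def)
      moreover from this have "x = (b \<otimes>\<^bsub>H\<^esub> h a) \<otimes>\<^bsub>H\<^esub> h z"
        using z A.subset B.subset AB by (simp add: H.m_assoc subset_iff)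
      moreover have "b \<otimes>\<^bsub>H\<^esub> h a \<in> B"
        using \<open>b \<in> B\<close> \<open>a \<in> A\<close> AB by blast
      ultimately show "x \<in> B #>\<^bsub>H\<^esub> h z"
        unfolding r_coset_def by blast
    qed
    show "B #>\<^bsub>H\<^esub> h z \<subseteq> ?\<phi> (A #>\<^bsub>G\<^esub> z)"
      using G.rcos_self[OF z A] by (auto simp: set_mult_def r_coset_def[of H])
  qed
  have rA: "A #>\<^bsub>G\<^esub> x = A #>\<^bsub>G\<^esub> y \<longleftrightarrow> x \<otimes>\<^bsub>G\<^esub> inv\<^bsub>G\<^esub> y \<in> A"
    if "x \<in> carrier G" "y \<in> carrier G" for x y
    using A.rcos_module[OF G.is_group that(2,1)] G.repr_independence[OF _ that(2) A]
      G.rcos_self[OF that(1) A] by blast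
  have rB: "B #>\<^bsub>H\<^esub> x = B #>\<^bsub>H\<^esub> y \<longleftrightarrow> x \<otimes>\<^bsub>H\<^esub> inv\<^bsub>H\<^esub> y \<in> B"
    if "x \<in> carrier H" "y \<in> carrier H" for x y
    using B.rcos_module[OF H.is_group that(2,1)] H.repr_independence[OF _ that(2) B]
      H.rcos_self[OF that(1) B] by blast
  have hom: "?\<phi> \<in> hom (G Mod A) (H Mod B)"
    by (rule homI) (auto simp: carrier_FactGroup \<phi> A.rcos_sum B.rcos_sum)
  have inj: "inj_on ?\<phi> (carrier (G Mod A)) \<longleftrightarrow> ?inj"
  proof
    assume i: "inj_on ?\<phi> (carrier (G Mod A))"
    show ?inj
    proof (intro ballI impI)
      fix z assume z: "z \<in> carrier G" "h z \<in> B"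
      have "?\<phi> (A #>\<^bsub>G\<^esub> z) = ?\<phi> (A #>\<^bsub>G\<^esub> \<one>\<^bsub>G\<^esub>)"
        unfolding \<phi>[OF z(1)] \<phi>[OF G.one_closed] using z by (subst rB) auto
      then have "A #>\<^bsub>G\<^esub> z = A #>\<^bsub>G\<^esub> \<one>\<^bsub>G\<^esub>"
        using z by (intro inj_onD[OF i]) (auto simp: carrier_FactGroup)
      then show "z \<in> A" using z by (subst (asm) rA) auto
    qed
  next
    assume i: ?inj
    show "inj_on ?\<phi> (carrier (G Mod A))"
    proof (rule inj_onI)
      fix X Y assume "X \<in> carrier (G Mod A)" "Y \<in> carrier (G Mod A)" and e: "?\<phi> X = ?\<phi> Y"
      then obtain x y where xy: "x \<in> carrier G" "y \<in> carrier G" "X = A #>\<^bsub>G\<^esub> x" "Y = A #>\<^bsub>G\<^esub> y"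
        by (auto simp: carrier_FactGroup)
      then have "h x \<otimes>\<^bsub>H\<^esub> inv\<^bsub>H\<^esub> h y \<in> B"
        using e rB[of "h x" "h y"] by (simp add: \<phi>)
      then have "h (x \<otimes>\<^bsub>G\<^esub> inv\<^bsub>G\<^esub> y) \<in> B" using xy by simp
      then show "X = Y" using i xy rA by simp
    qed
  qed
  have surj: "?\<phi> ` carrier (G Mod A) = carrier (H Mod B) \<longleftrightarrow> ?surj"
  proof -
    have "?\<phi> ` carrier (G Mod A) = (\<lambda>z. B #>\<^bsub>H\<^esub> h z) ` carrier G"
      by (auto simp: carrier_FactGroup \<phi> image_image)
    also have "\<dots> = carrier (H Mod B) \<longleftrightarrow>
        (\<forall>w\<in>carrier H. \<exists>z\<in>carrier G. B #>\<^bsub>H\<^esub> w = B #>\<^bsub>H\<^esub> h z)"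
      unfolding carrier_FactGroup by (auto simp: set_eq_iff image_iff)
    also have "\<dots> \<longleftrightarrow> ?surj" by (auto simp: rB)
    finally show ?thesis .
  qed
  show ?thesis using hom inj surj by (simp add: iso_def bij_betw_def)
qed

lemma (in comm_group) subgroup_comm_group:
  assumes "subgroup H G"
  shows "comm_group (G\<lparr>carrier := H\<rparr>)"
  using subgroup_imp_group[OF assms] subgroup.subset[OF assms] m_comm
  by (intro group.group_comm_groupI) auto

section \<open>Cycles and boundaries of a complex\<close>

locale complex =
  fixes C :: "'u complex"
  assumes chain_complex: "chain_complex C"
begin

lemma comm_group_grp: "comm_group (grp C n)"
  using chain_complex by (simp add: chain_complex_def)

sublocale grp: comm_group "grp C n" for n
  by (rule comm_group_grp)

lemma bd_hom: "bd C n \<in> hom (grp C (Suc n)) (grp C n)"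
  using chain_complex by (simp add: chain_complex_def)

sublocale bd: group_hom "grp C (Suc n)" "grp C n" "bd C n" for n
  using bd_hom by (simp add: group_hom_def group_hom_axioms_def grp.is_group)

lemma bd_bd: "x \<in> carrier (grp C (Suc (Suc n))) \<Longrightarrow> bd C n (bd C (Suc n) x) = \<one>\<^bsub>grp C n\<^esub>"
  using chain_complex by (simp add: chain_complex_def)

lemma subgroup_cycles: "subgroup (cycles C n) (grp C n)"
proof (cases n)
  case 0
  then show ?thesis using grp.subgroup_self by (simp add: cycles_def)
next
  case (Suc m)
  then show ?thesis using bd.subgroup_kernel by (simp add: cycles_def)
qed

lemma cycles_subset: "z \<in> cycles C n \<Longrightarrow> z \<in> carrier (grp C n)"
  using subgroup.subset[OF subgroup_cycles] by blast

lemma boundaries_subset: "boundaries C n \<subseteq> cycles C n"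
  by (cases n) (auto simp: boundaries_def cycles_def kernel_def bd_bd)

lemma subgroup_boundaries: "subgroup (boundaries C n) (grp C n)"
  using bd.img_is_subgroup by (simp add: boundaries_def)

lemma comm_group_cycles: "comm_group ((grp C n)\<lparr>carrier := cycles C n\<rparr>)"
  using grp.subgroup_comm_group[OF subgroup_cycles] .

lemma subgroup_boundaries_cycles:
  "subgroup (boundaries C n) ((grp C n)\<lparr>carrier := cycles C n\<rparr>)"
  using grp.subgroup_incl[OF subgroup_boundaries subgroup_cycles boundaries_subset] .

end

lemma chain_mapD:
  assumes "chain_map C D f"
  shows "f n \<in> hom (grp C n) (grp D n)" "f n \<in> extensional (carrier (grp C n))"
    "x \<in> carrier (grp C n) \<Longrightarrow> f n x \<in> carrier (grp D n)"
    "x \<in> carrier (grp C (Suc n)) \<Longrightarrow> f n (bd C n x) = bd D n (f (Suc n) x)"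
  using assms by (auto simp: chain_map_def hom_def)

lemma chain_map_group_hom:
  assumes "chain_complex C" "chain_complex D" "chain_map C D f"
  shows "group_hom (grp C n) (grp D n) (f n)"
proof -
  interpret C: complex C by unfold_locales fact
  interpret D: complex D by unfold_locales fact
  show ?thesis using chain_mapD(1)[OF assms(3)] by unfold_locales
qed

lemma chain_map_cycles:
  assumes "chain_complex C" "chain_complex D" "chain_map C D f" "z \<in> cycles C n"
  shows "f n z \<in> cycles D n"
  using assms(4) chain_mapD(3,4)[OF assms(3)] group_hom.hom_one[OF chain_map_group_hom[OF assms(1-3)]]
  by (cases n) (auto simp: cycles_def kernel_def, metis)

lemma chain_map_boundaries:
  assumes "chain_map C D f" "z \<in> boundaries C n"
  shows "f n z \<in> boundaries D n"
  using assms chain_mapD[OF assms(1)] by (auto simp: boundaries_def)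

text \<open>Homology is the quotient of the group of cycles by the boundaries, so the element
  criterion for quotient maps applies to the restriction of \<open>f n\<close> to cycles. Inverses
  may be formed in the whole chain group because the cycles are a subgroup.\<close>

lemma quasi_iso_iff:
  assumes C: "chain_complex C" and D: "chain_complex D" and f: "chain_map C D f"
  shows "quasi_iso C D f \<longleftrightarrow>
    (\<forall>n. \<forall>z\<in>cycles C n. f n z \<in> boundaries D n \<longrightarrow> z \<in> boundaries C n) \<and>
    (\<forall>n. \<forall>w\<in>cycles D n. \<exists>z\<in>cycles C n.
       w \<otimes>\<^bsub>grp D n\<^esub> inv\<^bsub>grp D n\<^esub> f n z \<in> boundaries D n)"
proof -
  interpret C: complex C by unfold_locales fact
  interpret D: complex D by unfold_locales fact
  have "homology_map D f n \<in> iso (homology C n) (homology D n) \<longleftrightarrow>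
      (\<forall>z\<in>cycles C n. f n z \<in> boundaries D n \<longrightarrow> z \<in> boundaries C n) \<and>
      (\<forall>w\<in>cycles D n. \<exists>z\<in>cycles C n.
         w \<otimes>\<^bsub>grp D n\<^esub> inv\<^bsub>grp D n\<^esub> f n z \<in> boundaries D n)" for n
  proof -
    let ?G = "(grp C n)\<lparr>carrier := cycles C n\<rparr>" and ?H = "(grp D n)\<lparr>carrier := cycles D n\<rparr>"
    have h: "f n \<in> hom ?G ?H"
      using chain_mapD(1)[OF f, of n] chain_map_cycles[OF C D f] C.cycles_subset
      by (auto simp: hom_def)
    have "inv\<^bsub>?H\<^esub> f n z = inv\<^bsub>grp D n\<^esub> f n z" if "z \<in> cycles C n" for z
      using D.grp.m_inv_consistent[OF D.subgroup_cycles chain_map_cycles[OF C D f that]] .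
    moreover have "homology_map D f n = (\<lambda>X. boundaries D n <#>\<^bsub>?H\<^esub> (f n ` X))"
      by (intro ext) (simp add: homology_map_def set_mult_def)
    moreover have "f n ` boundaries C n \<subseteq> boundaries D n"
      using chain_map_boundaries[OF f] by blast
    ultimately show ?thesis
      using quotient_map_iso_iff[OF C.comm_group_cycles D.comm_group_cycles
          C.subgroup_boundaries_cycles D.subgroup_boundaries_cycles h]
      by (simp add: homology_def)
  qed
  with f show ?thesis unfolding quasi_iso_def by blast
qed

section \<open>The category of complexes and its quasi-isomorphisms\<close>

lemma chain_map_id: "chain_complex C \<Longrightarrow> chain_map C C (\<lambda>n. restrict (\<lambda>x. x) (carrier (grp C n)))"
  by (auto simp: chain_map_def hom_def chain_complex_def comm_group_def comm_monoid_def monoid.m_closed Pi_iff)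

lemma chain_map_comp:
  assumes f: "chain_map C D f" and g: "chain_map D E g" and C: "chain_complex C"
  shows "chain_map C E (\<lambda>n. compose (carrier (grp C n)) (g n) (f n))"
proof -
  interpret C: complex C by unfold_locales fact
  have "compose (carrier (grp C n)) (g n) (f n) \<in> hom (grp C n) (grp E n)" for n
    using chain_mapD(1)[OF f, of n] chain_mapD(1)[OF g, of n]
    by (auto simp: hom_def compose_def Pi_iff)
  then show ?thesis
    using chain_mapD(3,4)[OF f] chain_mapD(3,4)[OF g]
    by (simp add: chain_map_def compose_def)
qed

lemma in_hom_Ch:
  "in_hom (Ch U) C a D \<longleftrightarrow>
     (\<exists>f. a = (C, f, D) \<and> C \<in> small_complexes U \<and> D \<in> small_complexes U \<and> chain_map C D f)"
  by (auto simp: in_hom_def Ch_def)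

lemma Ch_Comp:
  "Comp (Ch U) (D', g, E) (C, f, D) = (C, \<lambda>n. compose (carrier (grp C n)) (g n) (f n), E)"
  by (simp add: Ch_def)

lemma Ch_Ident: "Ident (Ch U) C = (C, \<lambda>n. restrict (\<lambda>x. x) (carrier (grp C n)), C)"
  by (simp add: Ch_def)

lemma compose_restrict_id:
  assumes "f \<in> extensional A"
  shows "compose A f (restrict (\<lambda>x. x) A) = f"
  using assms by (auto simp: compose_def extensional_def)

lemma compose_id_restrict:
  assumes "f \<in> extensional A" "f ` A \<subseteq> B"
  shows "compose A (restrict (\<lambda>x. x) B) f = f"
  using assms by (intro ext) (auto simp: compose_def extensional_def)

lemma category_Ch: "category (Ch U)"
proof -
  have cc: "chain_complex C" if "C \<in> small_complexes U" for C
    using that by (simp add: small_complexes_def)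
  have c: "f n ` carrier (grp C n) \<subseteq> carrier (grp D n)" if "chain_map C D f" for C D f n
    using chain_mapD(3)[OF that] by blast
  have a: "compose (carrier (grp C n)) (h n) (compose (carrier (grp C n)) (g n) (f n))
      = compose (carrier (grp C n)) (compose (carrier (grp D n)) (h n) (g n)) (f n)"
    if "chain_map C D f" for C D f g h n
    using chain_mapD(3)[OF that] by (auto simp: compose_def)
  show ?thesis
    unfolding category_def
    by (auto simp: Ch_def cc chain_map_id chain_map_comp compose_restrict_id compose_id_restrict[OF _ c]
        chain_mapD(2) a)
qed

text \<open>Lifts are composed: the boundary error made in \<open>D\<close> is mapped by
  \<open>g\<close> to a boundary in \<open>E\<close> and added to the error already present
  there.\<close>

lemma quasi_iso_comp:
  assumes C: "chain_complex C" and D: "chain_complex D" and E: "chain_complex E"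
    and f: "quasi_iso C D f" and g: "quasi_iso D E g"
  shows "quasi_iso C E (\<lambda>n. compose (carrier (grp C n)) (g n) (f n))"
proof -
  interpret C: complex C by unfold_locales fact
  interpret D: complex D by unfold_locales fact
  interpret E: complex E by unfold_locales fact
  have cf: "chain_map C D f" and cg: "chain_map D E g" using f g by (auto simp: quasi_iso_def)
  interpret f: group_hom "grp C n" "grp D n" "f n" for n by (rule chain_map_group_hom[OF C D cf])
  interpret g: group_hom "grp D n" "grp E n" "g n" for n by (rule chain_map_group_hom[OF D E cg])
  note fi = f[unfolded quasi_iso_iff[OF C D cf]] and gi = g[unfolded quasi_iso_iff[OF D E cg]]
  show ?thesis
    unfolding quasi_iso_iff[OF C E chain_map_comp[OF cf cg C]]
  proof (intro conjI allI ballI impI)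
    fix n z
    assume z: "z \<in> cycles C n" "compose (carrier (grp C n)) (g n) (f n) z \<in> boundaries E n"
    then show "z \<in> boundaries C n"
      using fi gi chain_map_cycles[OF C D cf z(1)] C.cycles_subset[OF z(1)] by (simp add: compose_def)
  next
    fix n w assume w: "w \<in> cycles E n"
    obtain y where y: "y \<in> cycles D n" "w \<otimes>\<^bsub>grp E n\<^esub> inv\<^bsub>grp E n\<^esub> g n y \<in> boundaries E n"
      using gi w by blast
    obtain z where z: "z \<in> cycles C n" "y \<otimes>\<^bsub>grp D n\<^esub> inv\<^bsub>grp D n\<^esub> f n z \<in> boundaries D n"
      using fi y(1) by blast
    have c: "w \<in> carrier (grp E n)" "y \<in> carrier (grp D n)" "z \<in> carrier (grp C n)"
      using w y z C.cycles_subset D.cycles_subset E.cycles_subset by auto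
    have cancel: "inv\<^bsub>grp E n\<^esub> a \<otimes>\<^bsub>grp E n\<^esub> (a \<otimes>\<^bsub>grp E n\<^esub> b) = b"
      if "a \<in> carrier (grp E n)" "b \<in> carrier (grp E n)" for a b
      using that by (simp add: E.grp.m_assoc[symmetric])
    have "g n (y \<otimes>\<^bsub>grp D n\<^esub> inv\<^bsub>grp D n\<^esub> f n z) \<in> boundaries E n"
      using chain_map_boundaries[OF cg z(2)] .
    then have "(w \<otimes>\<^bsub>grp E n\<^esub> inv\<^bsub>grp E n\<^esub> g n y) \<otimes>\<^bsub>grp E n\<^esub>
        g n (y \<otimes>\<^bsub>grp D n\<^esub> inv\<^bsub>grp D n\<^esub> f n z) \<in> boundaries E n"
      using subgroup.m_closed[OF E.subgroup_boundaries y(2)] by blast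
    also have "(w \<otimes>\<^bsub>grp E n\<^esub> inv\<^bsub>grp E n\<^esub> g n y) \<otimes>\<^bsub>grp E n\<^esub>
        g n (y \<otimes>\<^bsub>grp D n\<^esub> inv\<^bsub>grp D n\<^esub> f n z) = w \<otimes>\<^bsub>grp E n\<^esub> inv\<^bsub>grp E n\<^esub> g n (f n z)"
      using c cancel by (simp add: E.grp.m_assoc)
    finally show "\<exists>z\<in>cycles C n. w \<otimes>\<^bsub>grp E n\<^esub> inv\<^bsub>grp E n\<^esub>
        compose (carrier (grp C n)) (g n) (f n) z \<in> boundaries E n"
      using z(1) c by (auto simp: compose_def)
  qed
qed

lemma quasi_iso_of_inverse:
  assumes C: "chain_complex C" and D: "chain_complex D"
    and f: "chain_map C D f" and g: "chain_map D C g"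
    and gf: "\<And>n x. x \<in> carrier (grp C n) \<Longrightarrow> g n (f n x) = x"
    and fg: "\<And>n y. y \<in> carrier (grp D n) \<Longrightarrow> f n (g n y) = y"
  shows "quasi_iso C D f"
proof -
  interpret C: complex C by unfold_locales fact
  interpret D: complex D by unfold_locales fact
  show ?thesis
    unfolding quasi_iso_iff[OF C D f]
  proof (intro conjI allI ballI impI)
    fix n z assume z: "z \<in> cycles C n" "f n z \<in> boundaries D n"
    show "z \<in> boundaries C n"
      using chain_map_boundaries[OF g z(2)] gf C.cycles_subset[OF z(1)] by simp
  next
    fix n w assume w: "w \<in> cycles D n"
    have "w \<otimes>\<^bsub>grp D n\<^esub> inv\<^bsub>grp D n\<^esub> f n (g n w) = \<one>\<^bsub>grp D n\<^esub>"
      using fg D.cycles_subset[OF w] by simp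
    then show "\<exists>z\<in>cycles C n. w \<otimes>\<^bsub>grp D n\<^esub> inv\<^bsub>grp D n\<^esub> f n z \<in> boundaries D n"
      using chain_map_cycles[OF D C g w] subgroup.one_closed[OF D.subgroup_boundaries] by metis
  qed
qed


section \<open>Globular abelian groups\<close>

text \<open>The laws with \<open>i \<le> j\<close> say that every later map fixes an
  \<open>i\<close>-object, those with \<open>i < j\<close> that passing to a higher source or target
  leaves the lower ones unchanged. \<open>finite_dim\<close> speaks of \<open>s\<close> alone
  because \<open>ts\<close> makes \<open>t i\<close> fix every cell fixed by
  \<open>s i\<close>.\<close>

locale globular_group = comm_group G for G (structure) +
  fixes s t :: "nat \<Rightarrow> 'a \<Rightarrow> 'a"
  assumes s_hom: "s i \<in> hom G G" and t_hom: "t i \<in> hom G G"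
    and ss: "a \<in> carrier G \<Longrightarrow> i \<le> j \<Longrightarrow> s j (s i a) = s i a"
    and st: "a \<in> carrier G \<Longrightarrow> i \<le> j \<Longrightarrow> s j (t i a) = t i a"
    and ts: "a \<in> carrier G \<Longrightarrow> i \<le> j \<Longrightarrow> t j (s i a) = s i a"
    and tt: "a \<in> carrier G \<Longrightarrow> i \<le> j \<Longrightarrow> t j (t i a) = t i a"
    and ss': "a \<in> carrier G \<Longrightarrow> i < j \<Longrightarrow> s i (s j a) = s i a"
    and st': "a \<in> carrier G \<Longrightarrow> i < j \<Longrightarrow> s i (t j a) = s i a"
    and ts': "a \<in> carrier G \<Longrightarrow> i < j \<Longrightarrow> t i (s j a) = t i a"
    and tt': "a \<in> carrier G \<Longrightarrow> i < j \<Longrightarrow> t i (t j a) = t i a"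
    and finite_dim: "a \<in> carrier G \<Longrightarrow> \<exists>i. s i a = a"
begin

sublocale s: group_hom G G "s i" for i
  using s_hom by unfold_locales

sublocale t: group_hom G G "t i" for i
  using t_hom by unfold_locales

lemmas laws = ss st ts tt ss' st' ts' tt'

lemma inv_cancel: "a \<in> carrier G \<Longrightarrow> b \<in> carrier G \<Longrightarrow> inv a \<otimes> (a \<otimes> b) = b"
  and inv_cancel': "a \<in> carrier G \<Longrightarrow> b \<in> carrier G \<Longrightarrow> a \<otimes> (inv a \<otimes> b) = b"
  and diff_cancel: "a \<in> carrier G \<Longrightarrow> b \<in> carrier G \<Longrightarrow> a \<otimes> inv b \<otimes> b = a"
  by (simp_all add: m_assoc[symmetric]) (simp add: m_assoc)

lemma diff_eq_one: "a \<in> carrier G \<Longrightarrow> b \<in> carrier G \<Longrightarrow> a \<otimes> inv b = \<one> \<longleftrightarrow> a = b"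
  using diff_cancel[of a b] by auto

lemma inv_diff: "a \<in> carrier G \<Longrightarrow> b \<in> carrier G \<Longrightarrow> inv (a \<otimes> inv b) = b \<otimes> inv a"
  by (simp add: inv_mult m_comm)

lemma t_eq_self: "a \<in> carrier G \<Longrightarrow> s i a = a \<Longrightarrow> t i a = a"
  using ts[of a i i] by simp

lemma s_eq_self_mono: "a \<in> carrier G \<Longrightarrow> s i a = a \<Longrightarrow> i \<le> j \<Longrightarrow> s j a = a"
  using ss[of a i j] by simp

text \<open>A total formula, additive in the pair of arguments. Additivity is the compatibility of
  composition with the group operation, and most category laws then hold for all pairs of cells and
  not only for composable ones.\<close>

definition cmp :: "nat \<Rightarrow> 'a \<Rightarrow> 'a \<Rightarrow> 'a" where
  "cmp i a b = a \<otimes> (inv (s i a) \<otimes> b)"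

lemma cmp_closed: "a \<in> carrier G \<Longrightarrow> b \<in> carrier G \<Longrightarrow> cmp i a b \<in> carrier G"
  by (simp add: cmp_def)

lemma cmp_one: "cmp i \<one> \<one> = \<one>"
  by (simp add: cmp_def)

lemma cmp_mult:
  "a \<in> carrier G \<Longrightarrow> b \<in> carrier G \<Longrightarrow> a' \<in> carrier G \<Longrightarrow> b' \<in> carrier G \<Longrightarrow>
    cmp i (a \<otimes> a') (b \<otimes> b') = cmp i a b \<otimes> cmp i a' b'"
  by (simp add: cmp_def inv_mult m_ac)

lemma cmp_inv:
  "a \<in> carrier G \<Longrightarrow> b \<in> carrier G \<Longrightarrow> cmp i (inv a) (inv b) = inv (cmp i a b)"
  by (simp add: cmp_def inv_mult m_ac)

lemma s_cmp: "a \<in> carrier G \<Longrightarrow> b \<in> carrier G \<Longrightarrow> s i (cmp i a b) = s i b"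
  and t_cmp: "a \<in> carrier G \<Longrightarrow> b \<in> carrier G \<Longrightarrow> s i a = t i b \<Longrightarrow> t i (cmp i a b) = t i a"
  by (simp_all add: cmp_def laws inv_cancel')

lemma cmp_self: "a \<in> carrier G \<Longrightarrow> cmp i a (s i a) = a" "a \<in> carrier G \<Longrightarrow> cmp i (t i a) a = a"
  by (simp_all add: cmp_def laws inv_cancel')

lemma cmp_assoc:
  "a \<in> carrier G \<Longrightarrow> b \<in> carrier G \<Longrightarrow> c \<in> carrier G \<Longrightarrow>
    cmp i (cmp i a b) c = cmp i a (cmp i b c)"
  by (simp add: cmp_def laws m_assoc inv_cancel')

lemma s_cmp_less:
  "i < j \<Longrightarrow> a \<in> carrier G \<Longrightarrow> b \<in> carrier G \<Longrightarrow> s j (cmp i a b) = cmp i (s j a) (s j b)"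
  and t_cmp_less:
  "i < j \<Longrightarrow> a \<in> carrier G \<Longrightarrow> b \<in> carrier G \<Longrightarrow> t j (cmp i a b) = cmp i (t j a) (t j b)"
  by (simp_all add: cmp_def laws)

lemma cmp_interchange:
  assumes "i < j" and c: "a \<in> carrier G" "b \<in> carrier G" "a' \<in> carrier G" "b' \<in> carrier G"
  shows "cmp i (cmp j a b) (cmp j a' b') = cmp j (cmp i a a') (cmp i b b')"
proof -
  let ?x = "s i a"
  have "s i (cmp j a b) = s i b"
    using assms by (simp add: cmp_def laws inv_cancel')
  \<comment> \<open>The trivial factor \<open>inv ?x \<otimes> ?x\<close> is kept because the other
    side produces \<open>s i a\<close> with both signs, from \<open>cmp i a a'\<close> and from
    \<open>s j (cmp i a a')\<close>, and the two normal forms have to match.\<close>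
  then have "cmp i (cmp j a b) (cmp j a' b')
      = (inv ?x \<otimes> ?x) \<otimes> (a \<otimes> a' \<otimes> b \<otimes> b' \<otimes> inv (s j a) \<otimes> inv (s j a') \<otimes> inv (s i b))"
    using c by (simp add: cmp_def m_ac)
  also have "\<dots> = cmp j (cmp i a a') (cmp i b b')"
    using c \<open>i < j\<close> by (simp add: cmp_def laws inv_mult m_ac inv_cancel')
  finally show ?thesis .
qed

text \<open>In an abelian group object composition is determined by the group structure, since
  \<open>a *\<^sub>i b\<close> is the sum of \<open>a *\<^sub>i s\<^sub>i a\<close> and \<open>0 *\<^sub>i (b - s\<^sub>i a)\<close>.\<close>

definition picard :: "'a picard" where
  "picard = \<lparr> ocat = \<lparr> Cells = carrier G, Src = s, Tgt = t, Cmp = cmp \<rparr>,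
     pgrp = \<lparr> carrier = carrier G, mult = mult G, one = one G \<rparr> \<rparr>"

lemma picard_category_picard: "picard_category picard"
proof -
  \<comment> \<open>\<open>G\<close> may carry further record fields, whereas \<open>pgrp\<close> is
    a plain monoid; \<open>?G\<close> forgets them, so inverses have to be identified again.\<close>
  let ?G = "\<lparr> carrier = carrier G, mult = mult G, one = one G \<rparr>"
  have g: "comm_group ?G"
    by (rule comm_groupI) (auto simp: m_ac intro: l_inv_ex)
  then interpret G': comm_group ?G .
  have inv: "inv\<^bsub>?G\<^esub> a = inv a" if "a \<in> carrier G" for a
    using that by (intro G'.inv_equality) auto
  have fin: "\<exists>i. s i a = a \<and> t i a = a" if "a \<in> carrier G" for a
    using finite_dim[OF that] t_eq_self[OF that] by blast
  have "omega_category (ocat picard)"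
    unfolding omega_category_def
    by (auto simp: picard_def composable_def laws cmp_closed s_cmp t_cmp cmp_assoc s_cmp_less
        t_cmp_less cmp_self fin intro: cmp_interchange)
  then show ?thesis
    using g unfolding picard_category_def omega_functor_def
    by (auto simp: picard_def composable_def omega_prod_def omega_terminal_def inv cmp_closed
        cmp_mult cmp_inv cmp_one)
qed

text \<open>The globular analogue of the Moore complex of a simplicial group: all lower sources are
  killed, leaving one target as the differential.\<close>

definition normalized_cells :: "nat \<Rightarrow> 'a set" where
  "normalized_cells n = {a \<in> carrier G. s n a = a \<and> (\<forall>m<n. s m a = \<one>)}"

lemma normalized_cells_closed: "a \<in> normalized_cells n \<Longrightarrow> a \<in> carrier G"
  by (simp add: normalized_cells_def)

lemma subgroup_normalized_cells: "subgroup (normalized_cells n) G"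
  by (rule subgroupI) (auto simp: normalized_cells_def intro: exI[of _ \<one>])

lemma normalized_cells_s:
  "a \<in> normalized_cells n \<Longrightarrow> s i a = (if n \<le> i then a else \<one>)"
  using s_eq_self_mono by (auto simp: normalized_cells_def)

text \<open>If \<open>Suc i < n\<close> then \<open>t i a = t i (s (Suc i) a)\<close>, and the inner
  source vanishes. So only the target in codimension one survives, and the same vanishing makes its
  square trivial.\<close>

lemma normalized_cells_t:
  assumes a: "a \<in> normalized_cells n"
  shows "n \<le> i \<Longrightarrow> t i a = a" and "Suc i < n \<Longrightarrow> t i a = \<one>" and "n = Suc i \<Longrightarrow> t i a \<in> normalized_cells i"
proof -
  have c: "a \<in> carrier G" using a by (rule normalized_cells_closed)
  show "t i a = a" if "n \<le> i"
    using t_eq_self[OF c] normalized_cells_s[OF a] that by simp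
  show "t i a = \<one>" if "Suc i < n"
    using ts'[OF c, of i "Suc i"] normalized_cells_s[OF a, of "Suc i"] that by simp
  show "t i a \<in> normalized_cells i" if "n = Suc i"
    using c normalized_cells_s[OF a] that by (auto simp: normalized_cells_def laws)
qed

lemma normalized_cells_diff:
  assumes "a \<in> carrier G" "s (Suc n) a = a"
  shows "a \<otimes> inv (s n a) \<in> normalized_cells (Suc n)"
proof -
  have "s m a \<otimes> inv (s m (s n a)) = \<one>" if "m < Suc n" for m
    using assms that by (cases "m = n") (simp_all add: laws)
  then show ?thesis
    using assms by (simp add: normalized_cells_def laws)
qed

text \<open>Uniqueness half of the decomposition into normalized cells: subtracting
  \<open>s n a\<close> from an (n+1)-object leaves a normalized cell, and induction takes care of
  \<open>s n a\<close>.\<close>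

lemma hom_eqI:
  assumes "\<phi> \<in> hom G H" "\<psi> \<in> hom G H"
    and eq: "\<And>n x. x \<in> normalized_cells n \<Longrightarrow> \<phi> x = \<psi> x"
    and a: "a \<in> carrier G"
  shows "\<phi> a = \<psi> a"
proof -
  have "\<phi> a = \<psi> a" if "a \<in> carrier G" "s i a = a" for i a
    using that
  proof (induction i arbitrary: a)
    case 0
    then show ?case using eq[of a 0] by (simp add: normalized_cells_def)
  next
    case (Suc n)
    have "\<phi> (a \<otimes> inv (s n a)) = \<psi> (a \<otimes> inv (s n a))"
      using eq normalized_cells_diff[OF Suc.prems] by blast
    moreover have "\<phi> (s n a) = \<psi> (s n a)"
      using Suc by (simp add: laws)
    moreover have "\<chi> a = \<chi> (a \<otimes> inv (s n a)) \<otimes>\<^bsub>H\<^esub> \<chi> (s n a)" if "\<chi> \<in> hom G H" for \<chi>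
      using hom_mult[OF that, of "a \<otimes> inv (s n a)" "s n a"] Suc.prems by (simp add: diff_cancel)
    ultimately show ?case using assms(1,2) by metis
  qed
  with a finite_dim show ?thesis by blast
qed

end


section \<open>The complex of a Picard category\<close>

text \<open>The differential with index \<open>n\<close> leads from degree \<open>n + 1\<close> to
  degree \<open>n\<close>, just as the target with index \<open>n\<close> takes an (n+1)-object to
  an \<open>n\<close>-object, so no index shift appears. The carriers are spelled out to make the
  definition available outside the locale of globular groups.\<close>

definition normalized_complex :: "'u picard \<Rightarrow> 'u complex" where
  "normalized_complex A =
     \<lparr> grp = (\<lambda>n. (pgrp A)\<lparr>carrier := {a \<in> Cells (ocat A). Src (ocat A) n a = a \<and>
         (\<forall>m<n. Src (ocat A) m a = \<one>\<^bsub>pgrp A\<^esub>)}\<rparr>),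
       bd = Tgt (ocat A) \<rparr>"

locale picard_cat =
  fixes A :: "'u picard"
  assumes picard_category: "picard_category A"
begin

abbreviation "gr \<equiv> pgrp A"
abbreviation "src \<equiv> Src (ocat A)"
abbreviation "tgt \<equiv> Tgt (ocat A)"

lemma Cells_eq: "Cells (ocat A) = carrier (pgrp A)"
  using picard_category by (simp add: picard_category_def)

lemma omega_category: "omega_category (ocat A)"
  using picard_category by (simp add: picard_category_def)

lemma src_tgt_laws:
  assumes "a \<in> carrier (pgrp A)"
  shows "src i a \<in> carrier (pgrp A)" "tgt i a \<in> carrier (pgrp A)" "\<exists>i. src i a = a"
    "Cmp (ocat A) i a (src i a) = a" "Cmp (ocat A) i (tgt i a) a = a"
proof -
  have "\<forall>i. \<forall>a\<in>Cells (ocat A). src i a \<in> Cells (ocat A) \<and> tgt i a \<in> Cells (ocat A)"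
    "\<forall>i. \<forall>a\<in>Cells (ocat A). Cmp (ocat A) i a (src i a) = a \<and> Cmp (ocat A) i (tgt i a) a = a"
    "\<forall>a\<in>Cells (ocat A). \<exists>i. src i a = a \<and> tgt i a = a"
    using omega_category unfolding omega_category_def by - ((elim conjE, assumption)+)
  then show "src i a \<in> carrier (pgrp A)" "tgt i a \<in> carrier (pgrp A)" "\<exists>i. src i a = a"
    "Cmp (ocat A) i a (src i a) = a" "Cmp (ocat A) i (tgt i a) a = a"
    using assms by (auto simp: Cells_eq)
qed

lemma src_tgt_mult:
  assumes "a \<in> carrier (pgrp A)" "b \<in> carrier (pgrp A)"
  shows "src i (a \<otimes>\<^bsub>pgrp A\<^esub> b) = src i a \<otimes>\<^bsub>pgrp A\<^esub> src i b"
    "tgt i (a \<otimes>\<^bsub>pgrp A\<^esub> b) = tgt i a \<otimes>\<^bsub>pgrp A\<^esub> tgt i b"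
  using picard_category assms
  unfolding picard_category_def omega_functor_def by (simp_all add: omega_prod_def)

sublocale globular_group "pgrp A" "Src (ocat A)" "Tgt (ocat A)"
proof -
  have g: "comm_group (pgrp A)" and o: "omega_category (ocat A)"
    using picard_category by (auto simp: picard_category_def)
  have eq: "\<And>\<rho> \<sigma> i a. \<rho> \<in> {src, tgt} \<Longrightarrow> \<sigma> \<in> {src, tgt} \<Longrightarrow> a \<in> carrier (pgrp A) \<Longrightarrow> \<rho> i (\<sigma> i a) = \<sigma> i a"
    and less: "\<And>\<rho> \<sigma> i j a. \<rho> \<in> {src, tgt} \<Longrightarrow> \<sigma> \<in> {src, tgt} \<Longrightarrow> a \<in> carrier (pgrp A) \<Longrightarrow>
        i < j \<Longrightarrow> \<rho> j (\<sigma> i a) = \<sigma> i a \<and> \<sigma> i (\<rho> j a) = \<sigma> i a"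
    using o unfolding omega_category_def Cells_eq by (simp_all only:)
  have le: "\<rho> j (\<sigma> i a) = \<sigma> i a"
    if "\<rho> \<in> {src, tgt}" "\<sigma> \<in> {src, tgt}" "a \<in> carrier (pgrp A)" "i \<le> j" for \<rho> \<sigma> i j a
    using eq[OF that(1-3), of i] less[OF that(1-3), of i j] that(4) by (cases "i = j") auto
  have "src i \<in> hom (pgrp A) (pgrp A)" "tgt i \<in> hom (pgrp A) (pgrp A)" for i
    using src_tgt_laws src_tgt_mult by (auto simp: hom_def)
  moreover have "\<exists>i. src i a = a" if "a \<in> carrier (pgrp A)" for a
    using src_tgt_laws(3)[OF that] .
  ultimately show "globular_group (pgrp A) src tgt"
    using g le less by (simp add: globular_group_def globular_group_axioms_def)
qed

text \<open>An Eckmann-Hilton argument: addition is a functor, so the composite of the sums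
  \<open>a + 0\<close> and \<open>?x + ?y\<close> splits into two composites, and a unit law
  evaluates each. For the second this works because \<open>?y\<close> has target
  \<open>0\<close>.\<close>

lemma Cmp_eq:
  assumes a: "a \<in> carrier (pgrp A)" and b: "b \<in> carrier (pgrp A)" and ab: "src i a = tgt i b"
  shows "Cmp (ocat A) i a b = cmp i a b"
proof -
  let ?x = "src i a"
  let ?y = "inv\<^bsub>pgrp A\<^esub> ?x \<otimes>\<^bsub>pgrp A\<^esub> b"
  have "Cmp (ocat A) i (a \<otimes>\<^bsub>pgrp A\<^esub> \<one>\<^bsub>pgrp A\<^esub>) (?x \<otimes>\<^bsub>pgrp A\<^esub> ?y)
      = Cmp (ocat A) i a ?x \<otimes>\<^bsub>pgrp A\<^esub> Cmp (ocat A) i \<one>\<^bsub>pgrp A\<^esub> ?y"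
  proof -
    have "\<forall>i p q. composable (omega_prod (ocat A) (ocat A)) i p q \<longrightarrow>
        (\<lambda>(a, b). a \<otimes>\<^bsub>gr\<^esub> b) (Cmp (omega_prod (ocat A) (ocat A)) i p q)
        = Cmp (ocat A) i ((\<lambda>(a, b). a \<otimes>\<^bsub>gr\<^esub> b) p) ((\<lambda>(a, b). a \<otimes>\<^bsub>gr\<^esub> b) q)"
      using picard_category by (simp add: picard_category_def omega_functor_def)
    moreover have "composable (omega_prod (ocat A) (ocat A)) i (a, \<one>\<^bsub>gr\<^esub>) (?x, ?y)"
      using a b ab[symmetric] by (simp add: composable_def omega_prod_def Cells_eq laws)
    ultimately have "(\<lambda>(a, b). a \<otimes>\<^bsub>gr\<^esub> b) (Cmp (omega_prod (ocat A) (ocat A)) i (a, \<one>\<^bsub>gr\<^esub>) (?x, ?y))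
        = Cmp (ocat A) i ((\<lambda>(a, b). a \<otimes>\<^bsub>gr\<^esub> b) (a, \<one>\<^bsub>gr\<^esub>)) ((\<lambda>(a, b). a \<otimes>\<^bsub>gr\<^esub> b) (?x, ?y))"
      by blast
    then show ?thesis by (simp add: omega_prod_def)
  qed
  moreover have "Cmp (ocat A) i a ?x = a"
    using src_tgt_laws(4)[OF a] .
  moreover have "Cmp (ocat A) i (tgt i ?y) ?y = ?y"
    using a b by (intro src_tgt_laws(5)) simp
  moreover have "tgt i ?y = \<one>\<^bsub>pgrp A\<^esub>"
    using a b ab[symmetric] by (simp add: laws)
  ultimately show ?thesis
    using a b by (simp add: inv_cancel' cmp_def)
qed

section \<open>Cells of a Picard category in terms of cycles and boundaries\<close>

lemma i_objects_eq: "i_objects (ocat A) i = {a \<in> carrier (pgrp A). src i a = a}"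
  by (auto simp: i_objects_def Cells_eq laws image_iff) metis

text \<open>Invertibility is automatic, which removes the inverse cell from the notion of
  isomorphism.\<close>

lemma cell_iso_iff:
  "cell_iso (ocat A) i u a a' \<longleftrightarrow>
     u \<in> carrier (pgrp A) \<and> src (Suc i) u = u \<and> src i u = a \<and> tgt i u = a'"
proof
  assume u: "u \<in> carrier (pgrp A) \<and> src (Suc i) u = u \<and> src i u = a \<and> tgt i u = a'"
  then have a: "a \<in> carrier (pgrp A)" "a' \<in> carrier (pgrp A)" "u \<in> carrier (pgrp A)"
    "src i u = a" "tgt i u = a'" "src (Suc i) u = u"
    "\<And>j. i \<le> j \<Longrightarrow> src j a = a" "\<And>j. i \<le> j \<Longrightarrow> src j a' = a'"
    "\<And>j. i \<le> j \<Longrightarrow> tgt j a = a" "\<And>j. i \<le> j \<Longrightarrow> tgt j a' = a'"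
    using laws[of u i] by auto
  \<comment> \<open>Solving \<open>cmp i u v = a'\<close>, that is \<open>u - a + v = a'\<close>,
    leaves this as the only candidate.\<close>
  define v where "v = inv\<^bsub>gr\<^esub> u \<otimes>\<^bsub>gr\<^esub> (a \<otimes>\<^bsub>gr\<^esub> a')"
  have v: "v \<in> carrier gr" "src i v = a'" "tgt i v = a" "src (Suc i) v = v"
    using a by (simp_all add: v_def inv_cancel m_lcomm[of "inv\<^bsub>gr\<^esub> a'" a a'])
  have "Cmp (ocat A) i u v = a'"
    using a v(1) Cmp_eq[of u v i] v(3)
    by (simp add: cmp_def v_def m_lcomm[of _ "inv\<^bsub>gr\<^esub> u"] inv_cancel inv_cancel')
  moreover have "Cmp (ocat A) i v u = a"
    using a v(1,2) Cmp_eq[of v u i]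
    by (simp add: cmp_def v_def m_assoc m_lcomm[of a'] inv_cancel')
     (simp add: m_ac inv_cancel' del: inv_mult)
  ultimately show "cell_iso (ocat A) i u a a'"
    using a v unfolding cell_iso_def i_objects_eq by auto
qed (auto simp: cell_iso_def i_objects_eq)

lemma carrier_normalized_complex: "carrier (grp (normalized_complex A) n) = normalized_cells n"
  by (simp add: normalized_complex_def normalized_cells_def Cells_eq)

lemma grp_normalized_complex: "grp (normalized_complex A) n = gr\<lparr>carrier := normalized_cells n\<rparr>"
  by (simp add: normalized_complex_def normalized_cells_def Cells_eq)

lemma bd_normalized_complex: "bd (normalized_complex A) = tgt"
  by (simp add: normalized_complex_def)

lemma chain_complex_normalized_complex: "chain_complex (normalized_complex A)"
proof -
  have "tgt n \<in> hom (gr\<lparr>carrier := normalized_cells (Suc n)\<rparr>) (gr\<lparr>carrier := normalized_cells n\<rparr>)" for n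
    using normalized_cells_t(3) normalized_cells_closed by (auto simp: hom_def)
  moreover have "tgt n (tgt (Suc n) x) = \<one>\<^bsub>gr\<^esub>" if "x \<in> normalized_cells (Suc (Suc n))" for x n
    using normalized_cells_t(2)[OF that] normalized_cells_closed[OF that] by (simp add: laws)
  ultimately show ?thesis
    using subgroup_comm_group[OF subgroup_normalized_cells]
    by (simp add: chain_complex_def grp_normalized_complex bd_normalized_complex)
qed

sublocale N: complex "normalized_complex A"
  by unfold_locales (rule chain_complex_normalized_complex)

abbreviation "Z \<equiv> cycles (normalized_complex A)"
abbreviation "B \<equiv> boundaries (normalized_complex A)"

lemma cycles_normalized_complex:
  "Z n = {z \<in> normalized_cells n. \<forall>m. n = Suc m \<longrightarrow> tgt m z = \<one>\<^bsub>gr\<^esub>}"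
  by (cases n) (auto simp: cycles_def kernel_def grp_normalized_complex bd_normalized_complex)

lemma boundaries_normalized_complex: "B n = tgt n ` normalized_cells (Suc n)"
  by (simp add: boundaries_def carrier_normalized_complex bd_normalized_complex)

lemma inv_normalized_complex:
  "a \<in> normalized_cells n \<Longrightarrow> inv\<^bsub>grp (normalized_complex A) n\<^esub> a = inv\<^bsub>gr\<^esub> a"
  unfolding grp_normalized_complex using m_inv_consistent[OF subgroup_normalized_cells] .

lemma cycles_closed: "z \<in> Z n \<Longrightarrow> z \<in> carrier gr \<and> src n z = z"
  by (simp add: cycles_normalized_complex normalized_cells_def)

text \<open>Isomorphism of cells and surjectivity on homology subtract in opposite orders; this lets
  the two be matched.\<close>

lemma boundaries_diff_sym:
  assumes "a \<in> carrier gr" "b \<in> carrier gr"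
  shows "a \<otimes>\<^bsub>gr\<^esub> inv\<^bsub>gr\<^esub> b \<in> B n \<longleftrightarrow> b \<otimes>\<^bsub>gr\<^esub> inv\<^bsub>gr\<^esub> a \<in> B n"
proof -
  have "inv\<^bsub>gr\<^esub> x \<in> B n" if "x \<in> B n" for x
    using that subgroup.m_inv_closed[OF subgroup_normalized_cells] normalized_cells_closed
    by (fastforce simp: boundaries_normalized_complex image_iff intro: t.hom_inv[symmetric])
  then show ?thesis using inv_diff assms by metis
qed

text \<open>Subtracting \<open>a\<close>, regarded as its own identity, turns a cell from
  \<open>a\<close> to \<open>a'\<close> into one that starts at \<open>0\<close>, which is a chain
  with boundary \<open>a' - a\<close>. Adding \<open>a\<close> back reverses this.\<close>

lemma cells_isomorphic_iff:
  "cells_isomorphic (ocat A) i a a' \<longleftrightarrow> a \<in> carrier gr \<and> a' \<in> carrier gr \<and> src i a = a \<and>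
     src i a' = a' \<and> a' \<otimes>\<^bsub>gr\<^esub> inv\<^bsub>gr\<^esub> a \<in> B i"
proof
  assume "cells_isomorphic (ocat A) i a a'"
  then obtain u where u: "u \<in> carrier gr" "src (Suc i) u = u" "src i u = a" "tgt i u = a'"
    unfolding cells_isomorphic_def cell_iso_iff by blast
  then have "tgt i (u \<otimes>\<^bsub>gr\<^esub> inv\<^bsub>gr\<^esub> src i u) = a' \<otimes>\<^bsub>gr\<^esub> inv\<^bsub>gr\<^esub> a"
    using laws[of u i i] by auto
  then have "a' \<otimes>\<^bsub>gr\<^esub> inv\<^bsub>gr\<^esub> a \<in> B i"
    unfolding boundaries_normalized_complex
    by (rule image_eqI[OF HOL.sym normalized_cells_diff[OF u(1,2)]])
  then show "a \<in> carrier gr \<and> a' \<in> carrier gr \<and> src i a = a \<and> src i a' = a' \<and>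
      a' \<otimes>\<^bsub>gr\<^esub> inv\<^bsub>gr\<^esub> a \<in> B i"
    using u laws[of u i i] by auto
next
  assume *: "a \<in> carrier gr \<and> a' \<in> carrier gr \<and> src i a = a \<and> src i a' = a' \<and>
      a' \<otimes>\<^bsub>gr\<^esub> inv\<^bsub>gr\<^esub> a \<in> B i"
  then obtain x where x: "x \<in> normalized_cells (Suc i)" "a' \<otimes>\<^bsub>gr\<^esub> inv\<^bsub>gr\<^esub> a = tgt i x"
    by (auto simp: boundaries_normalized_complex)
  have "cell_iso (ocat A) i (x \<otimes>\<^bsub>gr\<^esub> a) a a'"
    unfolding cell_iso_iff
    using * x(2)[symmetric] normalized_cells_closed[OF x(1)] normalized_cells_s[OF x(1)]
      s_eq_self_mono[of a i "Suc i"] t_eq_self[of a i] by (simp add: diff_cancel)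
  then show "cells_isomorphic (ocat A) i a a'"
    by (auto simp: cells_isomorphic_def)
qed

text \<open>Equal sources in dimension \<open>i - 1\<close> force equal sources in all lower
  dimensions, so the difference is a chain; equal targets make it a cycle. For \<open>i = 0\<close>
  neither side imposes a condition.\<close>

lemma parallel_cells_iff:
  "parallel_cells (ocat A) i a a' \<longleftrightarrow> a \<in> carrier gr \<and> a' \<in> carrier gr \<and> src i a = a \<and>
     src i a' = a' \<and> a' \<otimes>\<^bsub>gr\<^esub> inv\<^bsub>gr\<^esub> a \<in> Z i"
proof (cases i)
  case 0
  then show ?thesis
    by (auto simp: parallel_cells_def i_objects_eq cycles_normalized_complex normalized_cells_def)
next
  case (Suc m)
  have "(\<forall>k<Suc m. src k a' \<otimes>\<^bsub>gr\<^esub> inv\<^bsub>gr\<^esub> src k a = \<one>\<^bsub>gr\<^esub>) \<longleftrightarrow> src m a = src m a'"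
    if "a \<in> carrier gr" "a' \<in> carrier gr"
  proof -
    have "src k a' = src k a" if "src m a = src m a'" "k < Suc m" for k
      using ss'[OF \<open>a \<in> carrier gr\<close>, of k m] ss'[OF \<open>a' \<in> carrier gr\<close>, of k m] that
      by (cases "k = m") auto
    with that show ?thesis by (auto simp: diff_eq_one)
  qed
  then show ?thesis
    using Suc by (auto simp: parallel_cells_def i_objects_eq cycles_normalized_complex
        normalized_cells_def diff_eq_one)
qed

end

section \<open>Additive functors and the chain maps they induce\<close>

lemma additive_functorD:
  assumes "picard_category A" "picard_category B" "additive_functor A B F"
  shows "group_hom (pgrp A) (pgrp B) F"
    "\<And>i a. a \<in> carrier (pgrp A) \<Longrightarrow> F (Src (ocat A) i a) = Src (ocat B) i (F a)"
    "\<And>i a. a \<in> carrier (pgrp A) \<Longrightarrow> F (Tgt (ocat A) i a) = Tgt (ocat B) i (F a)"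
proof -
  interpret A: picard_cat A by unfold_locales fact
  interpret B: picard_cat B by unfold_locales fact
  show "group_hom (pgrp A) (pgrp B) F"
    using assms(3) A.is_group B.is_group
    by (simp add: additive_functor_def group_hom_def group_hom_axioms_def)
  show "\<And>i a. a \<in> carrier (pgrp A) \<Longrightarrow> F (Src (ocat A) i a) = Src (ocat B) i (F a)"
    "\<And>i a. a \<in> carrier (pgrp A) \<Longrightarrow> F (Tgt (ocat A) i a) = Tgt (ocat B) i (F a)"
    using assms(3) by (simp_all add: additive_functor_def omega_functor_def A.Cells_eq)
qed

text \<open>Composition is expressed by sources and the group operations, so a map compatible with
  these preserves it as well.\<close>

lemma additive_functorI:
  assumes "picard_category A" "picard_category B" "group_hom (pgrp A) (pgrp B) F"
    and F: "F \<in> extensional (carrier (pgrp A))"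
    and s: "\<And>i a. a \<in> carrier (pgrp A) \<Longrightarrow> F (Src (ocat A) i a) = Src (ocat B) i (F a)"
    and t: "\<And>i a. a \<in> carrier (pgrp A) \<Longrightarrow> F (Tgt (ocat A) i a) = Tgt (ocat B) i (F a)"
  shows "additive_functor A B F"
proof -
  interpret A: picard_cat A by unfold_locales fact
  interpret B: picard_cat B by unfold_locales fact
  interpret F: group_hom "pgrp A" "pgrp B" F by fact
  have "F (Cmp (ocat A) i a b) = Cmp (ocat B) i (F a) (F b)"
    if "composable (ocat A) i a b" for i a b
  proof -
    from that have "a \<in> carrier (pgrp A)" "b \<in> carrier (pgrp A)" "Src (ocat A) i a = Tgt (ocat A) i b"
      by (auto simp: composable_def A.Cells_eq)
    then show ?thesis
      using s[of a i] t[of b i] by (simp add: A.Cmp_eq B.Cmp_eq A.cmp_def B.cmp_def)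
  qed
  then show ?thesis
    using F s t by (simp add: additive_functor_def omega_functor_def A.Cells_eq B.Cells_eq F.homh)
qed

text \<open>Restricting to chains makes the map extensional, as arrows of \<open>Ch\<close> are
  required to be, so that equality of arrows means equality on chains.\<close>

definition normalized_map :: "'u picard \<Rightarrow> ('u \<Rightarrow> 'u) \<Rightarrow> nat \<Rightarrow> 'u \<Rightarrow> 'u" where
  "normalized_map A F n = restrict F (carrier (grp (normalized_complex A) n))"

context
  fixes A B :: "'u picard" and F
  assumes A: "picard_category A" and B: "picard_category B" and F: "additive_functor A B F"
begin

interpretation A: picard_cat A by unfold_locales (rule A)
interpretation B: picard_cat B by unfold_locales (rule B)
interpretation F: group_hom "pgrp A" "pgrp B" F by (rule additive_functorD(1)[OF A B F])

lemma additive_functor_normalized_cells: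
  "x \<in> A.normalized_cells n \<Longrightarrow> F x \<in> B.normalized_cells n"
  by (auto simp: A.normalized_cells_def B.normalized_cells_def
      additive_functorD(2)[OF A B F, symmetric])

lemma chain_map_normalized_map:
  "chain_map (normalized_complex A) (normalized_complex B) (normalized_map A F)"
proof -
  have "normalized_map A F n \<in> hom (grp (normalized_complex A) n) (grp (normalized_complex B) n)" for n
    using additive_functor_normalized_cells A.normalized_cells_closed
      subgroup.m_closed[OF A.subgroup_normalized_cells]
    by (auto simp: normalized_map_def hom_def A.grp_normalized_complex B.grp_normalized_complex)
  then show ?thesis
    using A.normalized_cells_t(3) A.normalized_cells_closed
    by (auto simp: chain_map_def normalized_map_def A.carrier_normalized_complex
        A.bd_normalized_complex B.bd_normalized_complex additive_functorD(3)[OF A B F])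
qed

lemma additive_functor_cycles: "z \<in> A.Z n \<Longrightarrow> F z \<in> B.Z n"
  using chain_map_cycles[OF A.chain_complex_normalized_complex B.chain_complex_normalized_complex
      chain_map_normalized_map, of z n]
  by (simp add: normalized_map_def A.cycles_normalized_complex A.carrier_normalized_complex)

lemma quasi_iso_normalized_map_iff:
  "quasi_iso (normalized_complex A) (normalized_complex B) (normalized_map A F) \<longleftrightarrow>
    (\<forall>n. \<forall>z\<in>A.Z n. F z \<in> B.B n \<longrightarrow> z \<in> A.B n) \<and>
    (\<forall>n. \<forall>w\<in>B.Z n. \<exists>z\<in>A.Z n. w \<otimes>\<^bsub>pgrp B\<^esub> inv\<^bsub>pgrp B\<^esub> F z \<in> B.B n)"
proof -
  have F: "normalized_map A F n z = F z" "inv\<^bsub>grp (normalized_complex B) n\<^esub> F z = inv\<^bsub>pgrp B\<^esub> F z"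
    if "z \<in> A.Z n" for z n
    using that additive_functor_normalized_cells[of z n]
    by (simp_all add: A.cycles_normalized_complex normalized_map_def A.carrier_normalized_complex
        B.inv_normalized_complex)
  have m: "mult (grp (normalized_complex B) n) = mult (pgrp B)" for n
    by (simp add: B.grp_normalized_complex)
  show ?thesis
    unfolding quasi_iso_iff[OF A.chain_complex_normalized_complex B.chain_complex_normalized_complex
      chain_map_normalized_map]
    by (simp add: F m cong: ball_cong bex_cong)
qed

text \<open>Reflection of isomorphisms, tested against the zero cell, is injectivity on homology;
  surjectivity on objects is surjectivity in degree 0, and fullness between zero cells is
  surjectivity in higher degrees. Conversely, fullness for arbitrary \<open>a\<close> and
  \<open>a'\<close> is reduced to zero cells by subtracting the image of some cell from
  \<open>a\<close> to \<open>a'\<close>.\<close>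

lemma omega_equivalence_iff:
  "omega_equivalence (ocat A) (ocat B) F \<longleftrightarrow>
     quasi_iso (normalized_complex A) (normalized_complex B) (normalized_map A F)"
proof
  assume "omega_equivalence (ocat A) (ocat B) F"
  then have a: "\<forall>b\<in>i_objects (ocat B) 0. \<exists>a\<in>i_objects (ocat A) 0. cells_isomorphic (ocat B) 0 b (F a)"
    and b: "\<And>i a a' \<psi>. parallel_cells (ocat A) i a a' \<Longrightarrow> \<psi> \<in> i_objects (ocat B) (Suc i) \<Longrightarrow>
        Src (ocat B) i \<psi> = F a \<Longrightarrow> Tgt (ocat B) i \<psi> = F a' \<Longrightarrow>
        \<exists>\<phi>\<in>i_objects (ocat A) (Suc i). Src (ocat A) i \<phi> = a \<and> Tgt (ocat A) i \<phi> = a' \<and>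
          cells_isomorphic (ocat B) (Suc i) (F \<phi>) \<psi>"
    and c: "\<And>i a a'. parallel_cells (ocat A) i a a' \<Longrightarrow>
        cells_isomorphic (ocat B) i (F a) (F a') \<Longrightarrow> cells_isomorphic (ocat A) i a a'"
    unfolding omega_equivalence_def cells_isomorphic_def by blast+
  have "z \<in> A.B n" if z: "z \<in> A.Z n" "F z \<in> B.B n" for n z
  proof -
    \<comment> \<open>A cycle is a cell parallel to \<open>0\<close>, and it is isomorphic to
      \<open>0\<close> exactly when it is a boundary.\<close>
    have "cells_isomorphic (ocat A) n \<one>\<^bsub>pgrp A\<^esub> z"
      using z A.cycles_closed[OF z(1)] B.cycles_closed[OF additive_functor_cycles[OF z(1)]]
      by (intro c) (simp_all add: A.parallel_cells_iff B.cells_isomorphic_iff)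
    then show ?thesis by (auto simp: A.cells_isomorphic_iff)
  qed
  moreover have "\<exists>z\<in>A.Z n. w \<otimes>\<^bsub>pgrp B\<^esub> inv\<^bsub>pgrp B\<^esub> F z \<in> B.B n" if w: "w \<in> B.Z n" for n w
  proof (cases n)
    case 0
    then obtain z where z: "z \<in> i_objects (ocat A) 0" "cells_isomorphic (ocat B) 0 w (F z)"
      using a B.cycles_closed[OF w] by (auto simp: B.i_objects_eq)
    then show ?thesis
      using 0 B.boundaries_diff_sym[of w "F z" 0]
      by (intro bexI[of _ z]) (auto simp: A.i_objects_eq B.cells_isomorphic_iff A.cycles_normalized_complex
          A.normalized_cells_def)
  next
    case (Suc m)
    have w': "w \<in> carrier (pgrp B)" "Src (ocat B) (Suc m) w = w" "Src (ocat B) m w = \<one>\<^bsub>pgrp B\<^esub>"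
        "Tgt (ocat B) m w = \<one>\<^bsub>pgrp B\<^esub>"
      using w Suc by (auto simp: B.cycles_normalized_complex B.normalized_cells_def)
    \<comment> \<open>An (m+1)-object from \<open>0\<close> to \<open>0\<close> is the same as an
      (m+1)-cycle, so fullness for this pair lifts \<open>w\<close> up to isomorphism.\<close>
    have "parallel_cells (ocat A) m \<one>\<^bsub>pgrp A\<^esub> \<one>\<^bsub>pgrp A\<^esub>"
      using subgroup.one_closed[OF A.N.subgroup_cycles, of m]
      by (simp add: A.parallel_cells_iff A.grp_normalized_complex)
    from b[OF this, of w] w' obtain z where
      z: "z \<in> carrier (pgrp A)" "Src (ocat A) (Suc m) z = z" "Src (ocat A) m z = \<one>\<^bsub>pgrp A\<^esub>"
        "Tgt (ocat A) m z = \<one>\<^bsub>pgrp A\<^esub>" "cells_isomorphic (ocat B) (Suc m) (F z) w"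
      by (auto simp: A.i_objects_eq B.i_objects_eq)
    have "z \<in> A.normalized_cells (Suc m)"
      using A.normalized_cells_diff[OF z(1,2)] z(1,3) by simp
    then show ?thesis
      using z(4,5) Suc
      by (intro bexI[of _ z]) (simp_all add: A.cycles_normalized_complex B.cells_isomorphic_iff)
  qed
  ultimately show "quasi_iso (normalized_complex A) (normalized_complex B) (normalized_map A F)"
    unfolding quasi_iso_normalized_map_iff by blast
next
  assume "quasi_iso (normalized_complex A) (normalized_complex B) (normalized_map A F)"
  then have inj: "\<And>n z. z \<in> A.Z n \<Longrightarrow> F z \<in> B.B n \<Longrightarrow> z \<in> A.B n"
    and surj: "\<And>n w. w \<in> B.Z n \<Longrightarrow> \<exists>z\<in>A.Z n. w \<otimes>\<^bsub>pgrp B\<^esub> inv\<^bsub>pgrp B\<^esub> F z \<in> B.B n"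
    unfolding quasi_iso_normalized_map_iff by blast+
  have c: "cells_isomorphic (ocat A) i a a'"
    if "parallel_cells (ocat A) i a a'" "cells_isomorphic (ocat B) i (F a) (F a')" for i a a'
    using that inj[of "a' \<otimes>\<^bsub>pgrp A\<^esub> inv\<^bsub>pgrp A\<^esub> a" i]
    by (simp add: A.parallel_cells_iff A.cells_isomorphic_iff B.cells_isomorphic_iff)
  have a: "\<exists>a\<in>i_objects (ocat A) 0. cells_isomorphic (ocat B) 0 b (F a)"
    if "b \<in> i_objects (ocat B) 0" for b
  proof -
    have b: "b \<in> carrier (pgrp B)" "Src (ocat B) 0 b = b"
      using that by (auto simp: B.i_objects_eq)
    then have "b \<in> B.Z 0"
      by (simp add: B.cycles_normalized_complex B.normalized_cells_def)
    then obtain z where z: "z \<in> A.Z 0" "b \<otimes>\<^bsub>pgrp B\<^esub> inv\<^bsub>pgrp B\<^esub> F z \<in> B.B 0"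
      using surj by blast
    then show ?thesis
      using b A.cycles_closed[OF z(1)] B.cycles_closed[OF additive_functor_cycles[OF z(1)]]
        B.boundaries_diff_sym[of b "F z" 0]
      by (intro bexI[of _ z]) (auto simp: A.i_objects_eq B.cells_isomorphic_iff)
  qed
  have b: "\<exists>\<phi>\<in>i_objects (ocat A) (Suc i). Src (ocat A) i \<phi> = a \<and> Tgt (ocat A) i \<phi> = a' \<and>
          cells_isomorphic (ocat B) (Suc i) (F \<phi>) \<psi>"
    if p: "parallel_cells (ocat A) i a a'" and \<psi>: "\<psi> \<in> i_objects (ocat B) (Suc i)"
      "Src (ocat B) i \<psi> = F a" "Tgt (ocat B) i \<psi> = F a'" for i a a' \<psi>
  proof -
    have \<psi>': "\<psi> \<in> carrier (pgrp B)" "Src (ocat B) (Suc i) \<psi> = \<psi>"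
      using \<psi>(1) by (auto simp: B.i_objects_eq)
    \<comment> \<open>\<open>\<psi>\<close> itself joins \<open>F a\<close> to \<open>F a'\<close>,
      so injectivity already provides a cell \<open>u\<close> from \<open>a\<close> to
      \<open>a'\<close>; only its class remains to be corrected.\<close>
    have "cells_isomorphic (ocat B) i (F a) (F a')"
      using \<psi>' \<psi>(2,3) unfolding cells_isomorphic_def B.cell_iso_iff by blast
    from c[OF p this] obtain u where u: "u \<in> carrier (pgrp A)" "Src (ocat A) (Suc i) u = u"
        "Src (ocat A) i u = a" "Tgt (ocat A) i u = a'"
      unfolding cells_isomorphic_def A.cell_iso_iff by blast
    note Fs = additive_functorD(2,3)[OF A B F]
    \<comment> \<open>Having the same source and target, \<open>\<psi>\<close> and
      \<open>F u\<close> differ by a cycle. Surjectivity lifts its class to a cycle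
      \<open>z\<close>, and the corrected cell is \<open>u + z\<close>.\<close>
    let ?w = "\<psi> \<otimes>\<^bsub>pgrp B\<^esub> inv\<^bsub>pgrp B\<^esub> F u"
    have aa: "a \<in> carrier (pgrp A)" "a' \<in> carrier (pgrp A)" using u by auto
    have "?w \<in> B.normalized_cells (Suc i)"
    proof -
      have "Src (ocat B) i ?w = \<one>\<^bsub>pgrp B\<^esub>" "Src (ocat B) (Suc i) ?w = ?w"
        using u aa \<psi>' \<psi> by (simp_all add: Fs[symmetric])
      then show ?thesis using B.normalized_cells_diff[of ?w i] u \<psi>' by simp
    qed
    moreover have "Tgt (ocat B) i ?w = \<one>\<^bsub>pgrp B\<^esub>"
      using u aa \<psi>' \<psi> by (simp add: Fs[symmetric])
    ultimately have "?w \<in> B.Z (Suc i)" by (simp add: B.cycles_normalized_complex)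
    then obtain z where z: "z \<in> A.Z (Suc i)" "?w \<otimes>\<^bsub>pgrp B\<^esub> inv\<^bsub>pgrp B\<^esub> F z \<in> B.B (Suc i)"
      using surj by blast
    have z': "z \<in> carrier (pgrp A)" "Src (ocat A) (Suc i) z = z" "Src (ocat A) i z = \<one>\<^bsub>pgrp A\<^esub>"
        "Tgt (ocat A) i z = \<one>\<^bsub>pgrp A\<^esub>"
      using z(1) by (auto simp: A.cycles_normalized_complex A.normalized_cells_def)
    have "?w \<otimes>\<^bsub>pgrp B\<^esub> inv\<^bsub>pgrp B\<^esub> F z
        = \<psi> \<otimes>\<^bsub>pgrp B\<^esub> inv\<^bsub>pgrp B\<^esub> F (u \<otimes>\<^bsub>pgrp A\<^esub> z)"
      using u z' \<psi>' by (simp add: B.inv_mult B.m_assoc)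
    moreover have "Src (ocat B) (Suc i) (F (u \<otimes>\<^bsub>pgrp A\<^esub> z)) = F (u \<otimes>\<^bsub>pgrp A\<^esub> z)"
      using u z' by (simp add: Fs(1)[symmetric])
    ultimately have "cells_isomorphic (ocat B) (Suc i) (F (u \<otimes>\<^bsub>pgrp A\<^esub> z)) \<psi>"
      using z(2) u z' \<psi>' by (simp add: B.cells_isomorphic_iff)
    then show ?thesis
      using u z' aa by (intro bexI[of _ "u \<otimes>\<^bsub>pgrp A\<^esub> z"]) (auto simp: A.i_objects_eq)
  qed
  show "omega_equivalence (ocat A) (ocat B) F"
    unfolding omega_equivalence_def
    using F a b c by (auto simp: additive_functor_def cells_isomorphic_def[symmetric])
qed

end


section \<open>Full faithfulness\<close>

context globular_group
begin

definition component :: "nat \<Rightarrow> 'a \<Rightarrow> 'a" where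
  "component n a = (case n of 0 \<Rightarrow> s 0 a | Suc m \<Rightarrow> s (Suc m) a \<otimes> inv (s m a))"

lemma component_closed: "a \<in> carrier G \<Longrightarrow> component n a \<in> normalized_cells n"
proof (cases n)
  case 0
  then show "a \<in> carrier G \<Longrightarrow> component n a \<in> normalized_cells n"
    by (simp add: component_def normalized_cells_def laws)
next
  case (Suc m)
  then show "a \<in> carrier G \<Longrightarrow> component n a \<in> normalized_cells n"
    using normalized_cells_diff[of "s (Suc m) a" m] by (simp add: component_def laws)
qed

lemma component_mult:
  "a \<in> carrier G \<Longrightarrow> b \<in> carrier G \<Longrightarrow> component n (a \<otimes> b) = component n a \<otimes> component n b"
  by (simp add: component_def inv_mult m_ac split: nat.split)

lemma component_normalized_cells:
  "x \<in> normalized_cells n \<Longrightarrow> component m x = (if m = n then x else \<one>)"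
  using normalized_cells_closed[of x n]
  by (auto simp: component_def normalized_cells_s split: nat.split)

lemma component_eq_one:
  "a \<in> carrier G \<Longrightarrow> s i a = a \<Longrightarrow> i < m \<Longrightarrow> component m a = \<one>"
  using s_eq_self_mono[of a i] by (auto simp: component_def split: nat.split)

text \<open>Partial sums indexed by the last degree included; a cell has finitely many nontrivial
  components, so they become constant and no infinite sum is involved.\<close>

primrec sum_components :: "('c, 'd) monoid_scheme \<Rightarrow> (nat \<Rightarrow> 'a \<Rightarrow> 'c) \<Rightarrow> nat \<Rightarrow> 'a \<Rightarrow> 'c" where
  "sum_components H f 0 a = f 0 (component 0 a)"
| "sum_components H f (Suc k) a = sum_components H f k a \<otimes>\<^bsub>H\<^esub> f (Suc k) (component (Suc k) a)"

text \<open>Existence half of the decomposition: the value at \<open>a\<close> is the sum of the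
  \<open>f n\<close> over the components of \<open>a\<close>, and may be stopped at any dimension in
  which \<open>a\<close> is an object.\<close>

lemma hom_extension:
  assumes H: "comm_group H" and f: "\<And>n. f n \<in> hom (G\<lparr>carrier := normalized_cells n\<rparr>) H"
  obtains \<phi> where "\<phi> \<in> hom G H" "\<And>n x. x \<in> normalized_cells n \<Longrightarrow> \<phi> x = f n x"
proof -
  interpret H: comm_group H by fact
  have fc: "f n x \<in> carrier H" if "x \<in> normalized_cells n" for n x
    using hom_in_carrier[OF f[of n]] that by simp
  have fm: "f n (x \<otimes> y) = f n x \<otimes>\<^bsub>H\<^esub> f n y"
    if "x \<in> normalized_cells n" "y \<in> normalized_cells n" for n x y
    using hom_mult[OF f[of n]] that by simp
  have f1: "f n \<one> = \<one>\<^bsub>H\<^esub>" for n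
    using hom_one[OF f[of n] subgroup_imp_group[OF subgroup_normalized_cells] H.is_group] by simp
  let ?s = "sum_components H f"
  have closed: "?s k a \<in> carrier H" if "a \<in> carrier G" for k a
    by (induction k) (auto simp: fc component_closed that)
  have mult: "?s k (a \<otimes> b) = ?s k a \<otimes>\<^bsub>H\<^esub> ?s k b" if "a \<in> carrier G" "b \<in> carrier G" for k a b
    by (induction k) (simp_all add: component_mult fm component_closed that closed fc H.m_ac)
  have stable: "?s k a = ?s i a" if "a \<in> carrier G" "s i a = a" "i \<le> k" for a i k
    using \<open>i \<le> k\<close>
    by (induction k rule: dec_induct) (simp_all add: component_eq_one[OF that(1,2)] f1 closed that)
  \<comment> \<open>Every \<open>k\<close> with \<open>s k a = a\<close> gives the same value; the
    least one merely makes a choice. Two cells are later compared at the common bound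
    \<open>max i j\<close>.\<close>
  define \<phi> where "\<phi> a = ?s (LEAST i. s i a = a) a" for a
  have \<phi>: "\<phi> a = ?s k a" if "a \<in> carrier G" "s k a = a" for a k
    unfolding \<phi>_def
    using stable[OF that(1) LeastI[of "\<lambda>i. s i a = a", OF that(2)] Least_le[of "\<lambda>i. s i a = a", OF that(2)]]
    by simp
  have "\<phi> \<in> hom G H"
  proof (rule homI)
    fix a b assume ab: "a \<in> carrier G" "b \<in> carrier G"
    then obtain i j where "s i a = a" "s j b = b" using finite_dim by meson
    then have "s (max i j) a = a" "s (max i j) b = b"
      using s_eq_self_mono ab by simp_all
    then show "\<phi> (a \<otimes> b) = \<phi> a \<otimes>\<^bsub>H\<^esub> \<phi> b"
      using \<phi>[of _ "max i j"] ab mult by simp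
  next
    show "\<phi> a \<in> carrier H" if "a \<in> carrier G" for a
      using closed that by (simp add: \<phi>_def)
  qed
  moreover have "\<phi> x = f n x" if x: "x \<in> normalized_cells n" for n x
  proof -
    have c: "x \<in> carrier G" "s n x = x" using x by (auto simp: normalized_cells_def)
    have z: "?s m x = \<one>\<^bsub>H\<^esub>" if "m < n" for m
      using that by (induction m) (simp_all add: component_normalized_cells[OF x] f1)
    have "?s n x = f n x"
      using z fc[OF x] by (cases n) (simp_all add: component_normalized_cells[OF x])
    then show ?thesis using \<phi>[OF c] by simp
  qed
  ultimately show thesis by (rule that)
qed

end

text \<open>Extend \<open>f\<close> from normalized cells to a homomorphism. Compatibility with
  sources and targets is then an equality of homomorphisms, so it is enough to compare them on
  normalized cells.\<close>

lemma normalized_map_full: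
  assumes A: "picard_category A" and B: "picard_category B"
    and f: "chain_map (normalized_complex A) (normalized_complex B) f"
  obtains F where "additive_functor A B F" "normalized_map A F = f"
proof -
  interpret A: picard_cat A by unfold_locales fact
  interpret B: picard_cat B by unfold_locales fact
  have f_closed: "f n x \<in> B.normalized_cells n" if "x \<in> A.normalized_cells n" for n x
    using chain_mapD(3)[OF f] that
    by (simp add: A.carrier_normalized_complex B.carrier_normalized_complex)
  have f_tgt: "f n (A.tgt n x) = B.tgt n (f (Suc n) x)" if "x \<in> A.normalized_cells (Suc n)" for n x
    using chain_mapD(4)[OF f] that
    by (simp add: A.carrier_normalized_complex A.bd_normalized_complex B.bd_normalized_complex)
  have f_hom: "f n \<in> hom (pgrp A\<lparr>carrier := A.normalized_cells n\<rparr>) (pgrp B)" for n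
    using chain_mapD(1)[OF f, of n] B.normalized_cells_closed
    by (auto simp: hom_def A.grp_normalized_complex B.grp_normalized_complex)
  obtain \<phi> where \<phi>: "\<phi> \<in> hom (pgrp A) (pgrp B)"
      and \<phi>f: "\<And>n x. x \<in> A.normalized_cells n \<Longrightarrow> \<phi> x = f n x"
    using A.hom_extension[OF B.comm_group_axioms f_hom] by blast
  interpret \<phi>: group_hom "pgrp A" "pgrp B" \<phi>
    using \<phi> by unfold_locales
  have "\<phi> (A.src i a) = B.src i (\<phi> a)" if "a \<in> carrier (pgrp A)" for i a
  proof -
    have "(\<phi> \<circ> A.src i) a = (B.src i \<circ> \<phi>) a"
    proof (rule A.hom_eqI[OF hom_compose[OF A.s_hom \<phi>] hom_compose[OF \<phi> B.s_hom] _ that])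
      fix n x assume x: "x \<in> A.normalized_cells n"
      show "(\<phi> \<circ> A.src i) x = (B.src i \<circ> \<phi>) x"
        using A.normalized_cells_s[OF x] B.normalized_cells_s[OF f_closed[OF x]] \<phi>f[OF x] by simp
    qed
    then show ?thesis by simp
  qed
  moreover have "\<phi> (A.tgt i a) = B.tgt i (\<phi> a)" if "a \<in> carrier (pgrp A)" for i a
  proof -
    have "(\<phi> \<circ> A.tgt i) a = (B.tgt i \<circ> \<phi>) a"
    proof (rule A.hom_eqI[OF hom_compose[OF A.t_hom \<phi>] hom_compose[OF \<phi> B.t_hom] _ that])
      fix n x assume x: "x \<in> A.normalized_cells n"
      note tA = A.normalized_cells_t[OF x, of i] and tB = B.normalized_cells_t[OF f_closed[OF x], of i]
      \<comment> \<open>In the first two cases both targets act as the identity, respectively as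
        zero. Only codimension one uses that \<open>f\<close> is a chain map.\<close>
      consider "n \<le> i" | "Suc i < n" | "n = Suc i" by linarith
      then show "(\<phi> \<circ> A.tgt i) x = (B.tgt i \<circ> \<phi>) x"
        by cases (use tA tB \<phi>f x f_tgt in auto)
    qed
    then show ?thesis by simp
  qed
  ultimately have "additive_functor A B (restrict \<phi> (carrier (pgrp A)))"
    using \<phi>.homh
    by (intro additive_functorI[OF A B])
      (auto simp: group_hom_def group_hom_axioms_def A.is_group B.is_group hom_def)
  moreover have "normalized_map A (restrict \<phi> (carrier (pgrp A))) = f"
  proof (intro ext)
    fix n x
    show "normalized_map A (restrict \<phi> (carrier (pgrp A))) n x = f n x"
      using \<phi>f[of x n] A.normalized_cells_closed[of x n] chain_mapD(2)[OF f, of n]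
      by (cases "x \<in> A.normalized_cells n")
        (auto simp: normalized_map_def A.carrier_normalized_complex extensional_def)
  qed
  ultimately show thesis by (rule that)
qed

text \<open>Normalized cells generate the group, and outside the cells both functions take the
  default value of extensional functions.\<close>

lemma normalized_map_faithful:
  assumes A: "picard_category A" and B: "picard_category B"
    and F: "additive_functor A B F" and G: "additive_functor A B G"
    and eq: "normalized_map A F = normalized_map A G"
  shows "F = G"
proof
  interpret A: picard_cat A by unfold_locales fact
  fix a
  have "F x = G x" if "x \<in> A.normalized_cells n" for n x
    using fun_cong[OF fun_cong[OF eq, of n], of x] that
    by (simp add: normalized_map_def A.carrier_normalized_complex)
  then have "F a = G a" if "a \<in> carrier (pgrp A)"
    using A.hom_eqI[of F "pgrp B" G a] F G that by (auto simp: additive_functor_def)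
  moreover have "F a = G a" if "a \<notin> carrier (pgrp A)"
    using F G that by (auto simp: additive_functor_def extensional_def A.Cells_eq)
  ultimately show "F a = G a" by blast
qed

section \<open>The category of Picard omega-categories\<close>

lemma in_hom_Pic_omega:
  "in_hom (Pic_omega U) A a B \<longleftrightarrow>
     (\<exists>F. a = (A, F, B) \<and> A \<in> small_picards U \<and> B \<in> small_picards U \<and> additive_functor A B F)"
  by (auto simp: in_hom_def Pic_omega_def)

lemma category_Pic_omega: "category (Pic_omega U)"
proof -
  have p: "picard_category A" if "A \<in> small_picards U" for A
    using that by (simp add: small_picards_def)
  have id: "additive_functor A A (restrict (\<lambda>x. x) (Cells (ocat A)))" if "A \<in> small_picards U" for A
  proof -
    interpret A: picard_cat A by unfold_locales (rule p[OF that])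
    show ?thesis
      by (intro additive_functorI[OF p[OF that] p[OF that]])
        (auto simp: group_hom_def group_hom_axioms_def A.is_group hom_def A.Cells_eq)
  qed
  have comp: "additive_functor A D (compose (Cells (ocat A)) G F)"
    if "A \<in> small_picards U" "B \<in> small_picards U" "D \<in> small_picards U"
      and F: "additive_functor A B F" and G: "additive_functor B D G" for A B D F G
  proof -
    interpret A: picard_cat A by unfold_locales (rule p[OF that(1)])
    interpret B: picard_cat B by unfold_locales (rule p[OF that(2)])
    interpret D: picard_cat D by unfold_locales (rule p[OF that(3)])
    note F' = additive_functorD[OF p[OF that(1)] p[OF that(2)] F]
    note G' = additive_functorD[OF p[OF that(2)] p[OF that(3)] G]
    interpret F: group_hom "pgrp A" "pgrp B" F by (rule F')
    interpret G: group_hom "pgrp B" "pgrp D" G by (rule G')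
    show ?thesis
      by (intro additive_functorI[OF p[OF that(1)] p[OF that(3)]])
        (auto simp: group_hom_def group_hom_axioms_def A.is_group D.is_group hom_def A.Cells_eq
          compose_def F'(2,3) G'(2,3))
  qed
  have c: "F ` Cells (ocat A) \<subseteq> Cells (ocat B)" and e: "F \<in> extensional (Cells (ocat A))"
    if "additive_functor A B F" for A B F
    using that by (auto simp: additive_functor_def omega_functor_def)
  have a: "compose (Cells (ocat A)) H (compose (Cells (ocat A)) G F)
      = compose (Cells (ocat A)) (compose (Cells (ocat B)) H G) F"
    if "additive_functor A B F" for A B F G H
    using c[OF that] by (auto simp: compose_def fun_eq_iff restrict_def)
  show ?thesis
    unfolding category_def
    by (auto simp: Pic_omega_def id comp compose_restrict_id[OF e] compose_id_restrict[OF e c] a)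
qed


section \<open>The normalization functor\<close>

definition normalized_arrow :: "'u picard_arrow \<Rightarrow> 'u complex_arrow" where
  "normalized_arrow = (\<lambda>(A, F, B). (normalized_complex A, normalized_map A F, normalized_complex B))"

lemma small_normalized_complex:
  assumes "universe U" "A \<in> small_picards U"
  shows "normalized_complex A \<in> small_complexes U"
proof -
  interpret A: picard_cat A using assms(2) by unfold_locales (simp add: small_picards_def)
  have "A.normalized_cells n \<in> U" for n
  proof (rule universe_subset[OF assms(1)])
    show "Cells (ocat A) \<in> U" using assms(2) by (simp add: small_picards_def)
    show "A.normalized_cells n \<subseteq> Cells (ocat A)"
      using A.normalized_cells_closed by (auto simp: A.Cells_eq)
  qed
  then show ?thesis
    using A.chain_complex_normalized_complex
    by (auto simp: small_complexes_def small_picards_def A.carrier_normalized_complex)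
qed

lemma functor_normalized:
  assumes U: "universe U"
  shows "is_functor (Pic_omega U) (Ch U) normalized_complex normalized_arrow"
proof -
  have p: "picard_category A" if "A \<in> small_picards U" for A
    using that by (simp add: small_picards_def)
  have id: "normalized_map A (restrict (\<lambda>x. x) (Cells (ocat A)))
      = (\<lambda>n. restrict (\<lambda>x. x) (carrier (grp (normalized_complex A) n)))"
    if "A \<in> small_picards U" for A
  proof -
    interpret A: picard_cat A by unfold_locales (rule p[OF that])
    show ?thesis
      using A.normalized_cells_closed
      by (auto simp: normalized_map_def A.Cells_eq A.carrier_normalized_complex fun_eq_iff restrict_def)
  qed
  have comp: "normalized_map A (compose (Cells (ocat A)) G F)
      = (\<lambda>n. compose (carrier (grp (normalized_complex A) n)) (normalized_map B G n) (normalized_map A F n))"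
    if "A \<in> small_picards U" "B \<in> small_picards U" and F: "additive_functor A B F" for A B F G
  proof -
    interpret A: picard_cat A by unfold_locales (rule p[OF that(1)])
    interpret B: picard_cat B by unfold_locales (rule p[OF that(2)])
    show ?thesis
      using A.normalized_cells_closed additive_functor_normalized_cells[OF p[OF that(1)] p[OF that(2)] F]
      by (auto simp: normalized_map_def A.Cells_eq A.carrier_normalized_complex
          B.carrier_normalized_complex fun_eq_iff restrict_def compose_def)
  qed
  show ?thesis
    unfolding is_functor_def
    by (auto simp: Pic_omega_def Ch_def normalized_arrow_def small_normalized_complex[OF U] id comp
        chain_map_normalized_map p)
qed

lemma normalized_arrow_full:
  assumes "A \<in> Obj (Pic_omega U)" "B \<in> Obj (Pic_omega U)"
    and "in_hom (Ch U) (normalized_complex A) g (normalized_complex B)"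
  shows "\<exists>f. in_hom (Pic_omega U) A f B \<and> normalized_arrow f = g"
proof -
  have AB: "A \<in> small_picards U" "B \<in> small_picards U"
    using assms(1,2) by (simp_all add: Pic_omega_def)
  then have p: "picard_category A" "picard_category B"
    by (simp_all add: small_picards_def)
  obtain f where f: "g = (normalized_complex A, f, normalized_complex B)"
      "chain_map (normalized_complex A) (normalized_complex B) f"
    using assms(3) by (auto simp: in_hom_Ch)
  obtain F where "additive_functor A B F" "normalized_map A F = f"
    using normalized_map_full[OF p f(2)] .
  then show ?thesis
    using AB f(1) by (intro exI[of _ "(A, F, B)"]) (simp add: in_hom_Pic_omega normalized_arrow_def)
qed

lemma normalized_arrow_faithful:
  assumes "in_hom (Pic_omega U) A f B" "in_hom (Pic_omega U) A g B"
    and "normalized_arrow f = normalized_arrow g"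
  shows "f = g"
  using assms normalized_map_faithful
  by (auto simp: in_hom_Pic_omega normalized_arrow_def small_picards_def)


section \<open>Essential surjectivity\<close>

context complex
begin

definition sequences :: "(nat \<Rightarrow> 'u) set" where
  "sequences = finite_support (\<lambda>n. carrier (grp C n)) (\<lambda>n. \<one>\<^bsub>grp C n\<^esub>)"

definition trunc :: "nat \<Rightarrow> (nat \<Rightarrow> 'u) \<Rightarrow> nat \<Rightarrow> 'u" where
  "trunc i c n = (if n \<le> i then c n else \<one>\<^bsub>grp C n\<^esub>)"

text \<open>The formula is forced by the behaviour of targets on normalized cells: components of
  degree at most \<open>i\<close> are fixed, the one of degree \<open>i + 1\<close> goes to its
  boundary, and the rest are killed.\<close>

definition trunc_bd :: "nat \<Rightarrow> (nat \<Rightarrow> 'u) \<Rightarrow> nat \<Rightarrow> 'u" where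
  "trunc_bd i c n = (if n < i then c n
     else if n = i then c n \<otimes>\<^bsub>grp C n\<^esub> bd C n (c (Suc n)) else \<one>\<^bsub>grp C n\<^esub>)"

definition single :: "nat \<Rightarrow> 'u \<Rightarrow> nat \<Rightarrow> 'u" where
  "single n x k = (if k = n then x else \<one>\<^bsub>grp C k\<^esub>)"

definition seq_mult :: "(nat \<Rightarrow> 'u) \<Rightarrow> (nat \<Rightarrow> 'u) \<Rightarrow> nat \<Rightarrow> 'u" where
  "seq_mult c c' n = c n \<otimes>\<^bsub>grp C n\<^esub> c' n"

definition seq_one :: "nat \<Rightarrow> 'u" where
  "seq_one n = \<one>\<^bsub>grp C n\<^esub>"

lemma sequencesD: "c \<in> sequences \<Longrightarrow> c n \<in> carrier (grp C n)"
  by (simp add: sequences_def finite_support_def)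

lemma sequencesI:
  "(\<And>n. c n \<in> carrier (grp C n)) \<Longrightarrow> (\<And>n. n > N \<Longrightarrow> c n = \<one>\<^bsub>grp C n\<^esub>) \<Longrightarrow> c \<in> sequences"
  by (auto simp: sequences_def finite_support_def intro!: exI[of _ "Suc N"])

lemma sequences_closed:
  assumes c: "c \<in> sequences"
  shows "trunc i c \<in> sequences" "trunc_bd i c \<in> sequences"
    "(\<lambda>n. inv\<^bsub>grp C n\<^esub> c n) \<in> sequences" "c' \<in> sequences \<Longrightarrow> seq_mult c c' \<in> sequences"
    "x \<in> carrier (grp C n) \<Longrightarrow> single n x \<in> sequences" "seq_one \<in> sequences"
proof -
  obtain N where N: "\<And>n. n \<ge> N \<Longrightarrow> c n = \<one>\<^bsub>grp C n\<^esub>"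
    using c by (auto simp: sequences_def finite_support_def)
  note cn = sequencesD[OF c]
  show "trunc i c \<in> sequences" by (rule sequencesI[of _ i]) (auto simp: trunc_def cn)
  show "trunc_bd i c \<in> sequences" by (rule sequencesI[of _ i]) (auto simp: trunc_bd_def cn)
  show "(\<lambda>n. inv\<^bsub>grp C n\<^esub> c n) \<in> sequences" by (rule sequencesI[of _ N]) (auto simp: cn N)
  show "x \<in> carrier (grp C n) \<Longrightarrow> single n x \<in> sequences"
    by (rule sequencesI[of _ n]) (auto simp: single_def)
  show "seq_one \<in> sequences" by (rule sequencesI[of _ 0]) (auto simp: seq_one_def)
  show "seq_mult c c' \<in> sequences" if c': "c' \<in> sequences"
  proof -
    obtain N' where "\<And>n. n \<ge> N' \<Longrightarrow> c' n = \<one>\<^bsub>grp C n\<^esub>"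
      using c' by (auto simp: sequences_def finite_support_def)
    then show ?thesis
      by (intro sequencesI[of _ "max N N'"]) (auto simp: seq_mult_def cn sequencesD[OF c'] N)
  qed
qed

lemma seq_one_closed: "seq_one \<in> sequences"
  by (rule sequencesI[of _ 0]) (auto simp: seq_one_def)

text \<open>Only the last law, for \<open>j = Suc i\<close>, involves the differential squaring to
  zero: what degree \<open>i + 2\<close> contributes to degree \<open>i\<close> is a double
  boundary.\<close>

lemma trunc_laws:
  assumes "c \<in> sequences"
  shows "i \<le> j \<Longrightarrow> trunc j (trunc i c) = trunc i c"
    "i \<le> j \<Longrightarrow> trunc j (trunc_bd i c) = trunc_bd i c"
    "i \<le> j \<Longrightarrow> trunc_bd j (trunc i c) = trunc i c"
    "i \<le> j \<Longrightarrow> trunc_bd j (trunc_bd i c) = trunc_bd i c"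
    "i < j \<Longrightarrow> trunc i (trunc j c) = trunc i c"
    "i < j \<Longrightarrow> trunc i (trunc_bd j c) = trunc i c"
    "i < j \<Longrightarrow> trunc_bd i (trunc j c) = trunc_bd i c"
    "i < j \<Longrightarrow> trunc_bd i (trunc_bd j c) = trunc_bd i c"
  using sequencesD[OF assms] by (auto simp: trunc_def trunc_bd_def fun_eq_iff bd_bd)

lemma trunc_mult:
  assumes "c \<in> sequences" "c' \<in> sequences"
  shows "trunc i (seq_mult c c') = seq_mult (trunc i c) (trunc i c')"
    "trunc_bd i (seq_mult c c') = seq_mult (trunc_bd i c) (trunc_bd i c')"
  using sequencesD[OF assms(1)] sequencesD[OF assms(2)]
  by (auto simp: trunc_def trunc_bd_def seq_mult_def fun_eq_iff grp.m_ac)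

text \<open>The direct sum with its truncations is a globular group, transported along the code
  \<open>e\<close> because cells must have the type of the chains. Its normalized cells encode
  sequences concentrated in one degree, so \<open>f\<close> reads off an entry and \<open>g\<close>
  inserts one.\<close>

lemma picard_of_complex:
  assumes e: "inj_on e sequences"
  obtains A f g where "picard_category A" "Cells (ocat A) = e ` sequences"
    "chain_map (normalized_complex A) C f" "chain_map C (normalized_complex A) g"
    "\<And>n x. x \<in> carrier (grp (normalized_complex A) n) \<Longrightarrow> g n (f n x) = x"
    "\<And>n y. y \<in> carrier (grp C n) \<Longrightarrow> f n (g n y) = y"
proof -
  define d where "d = inv_into sequences e"
  have d: "d (e c) = c" if "c \<in> sequences" for c
    using e that by (simp add: d_def)
  define G where "G = \<lparr> carrier = e ` sequences, mult = (\<lambda>x y. e (seq_mult (d x) (d y))), one = e seq_one \<rparr>"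
  define s where "s i x = e (trunc i (d x))" for i x
  define t where "t i x = e (trunc_bd i (d x))" for i x
  have G: "carrier G = e ` sequences" "one G = e seq_one"
    "\<And>c c'. c \<in> sequences \<Longrightarrow> c' \<in> sequences \<Longrightarrow> mult G (e c) (e c') = e (seq_mult c c')"
    "\<And>i c. c \<in> sequences \<Longrightarrow> s i (e c) = e (trunc i c)"
    "\<And>i c. c \<in> sequences \<Longrightarrow> t i (e c) = e (trunc_bd i c)"
    by (simp_all add: G_def s_def t_def d)
  have mult: "seq_mult (seq_mult c c') c'' = seq_mult c (seq_mult c' c'')" "seq_mult c c' = seq_mult c' c"
    "seq_mult seq_one c = c" "seq_mult (\<lambda>n. inv\<^bsub>grp C n\<^esub> c n) c = seq_one"
    if "c \<in> sequences" "c' \<in> sequences" "c'' \<in> sequences" for c c' c''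
    using that sequencesD by (simp_all add: seq_mult_def seq_one_def fun_eq_iff grp.m_ac)
  have "comm_group G"
  proof (rule comm_groupI)
    show "\<exists>y\<in>carrier G. y \<otimes>\<^bsub>G\<^esub> x = \<one>\<^bsub>G\<^esub>" if "x \<in> carrier G" for x
    proof -
      obtain c where c: "c \<in> sequences" "x = e c" using \<open>x \<in> carrier G\<close> by (auto simp: G)
      then show ?thesis
        using sequences_closed(3)[OF c(1)] mult(4)[OF c(1) c(1) c(1)]
        by (intro bexI[of _ "e (\<lambda>n. inv\<^bsub>grp C n\<^esub> c n)"]) (simp_all add: G)
    qed
    show "x \<otimes>\<^bsub>G\<^esub> y = y \<otimes>\<^bsub>G\<^esub> x" if "x \<in> carrier G" "y \<in> carrier G" for x y
      using that mult(2) by (auto simp: G)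
  qed (auto simp: G sequences_closed seq_one_closed mult(1,3))
  moreover have fin: "\<exists>i. trunc i c = c" if "c \<in> sequences" for c
  proof -
    obtain N where "\<And>n. n \<ge> N \<Longrightarrow> c n = \<one>\<^bsub>grp C n\<^esub>"
      using \<open>c \<in> sequences\<close> by (auto simp: sequences_def finite_support_def)
    then have "trunc N c = c" by (auto simp: trunc_def fun_eq_iff)
    then show ?thesis ..
  qed
  ultimately interpret gg: globular_group G s t
    by (auto simp: globular_group_def globular_group_axioms_def hom_def G sequences_closed
        trunc_laws trunc_mult) metis
  let ?A = "gg.picard"
  have A: "picard_category ?A" by (rule gg.picard_category_picard)
  interpret A: picard_cat ?A by unfold_locales (rule A)
  have sel: "Cells (ocat ?A) = e ` sequences" "pgrp ?A = G" "Src (ocat ?A) = s" "Tgt (ocat ?A) = t"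
    unfolding gg.picard_def by (simp_all add: G_def)
  \<comment> \<open>Being fixed by \<open>trunc n\<close> empties the degrees above
    \<open>n\<close>, and being killed by the lower truncations empties those below.\<close>
  have cells: "gg.normalized_cells n = (\<lambda>x. e (single n x)) ` carrier (grp C n)" for n
  proof
    show "(\<lambda>x. e (single n x)) ` carrier (grp C n) \<subseteq> gg.normalized_cells n"
    proof
      fix y assume "y \<in> (\<lambda>x. e (single n x)) ` carrier (grp C n)"
      then obtain x where x: "x \<in> carrier (grp C n)" "y = e (single n x)" by blast
      then have S: "single n x \<in> sequences" using sequences_closed(5)[OF seq_one_closed] by simp
      have "trunc n (single n x) = single n x" "\<And>m. m < n \<Longrightarrow> trunc m (single n x) = seq_one"
        by (auto simp: trunc_def single_def seq_one_def fun_eq_iff)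
      then show "y \<in> gg.normalized_cells n"
        unfolding gg.normalized_cells_def using S x by (simp add: G)
    qed
    show "gg.normalized_cells n \<subseteq> (\<lambda>x. e (single n x)) ` carrier (grp C n)"
    proof
      fix y assume "y \<in> gg.normalized_cells n"
      then obtain c where c: "c \<in> sequences" "y = e c" "e (trunc n c) = e c"
          "\<And>m. m < n \<Longrightarrow> e (trunc m c) = e seq_one"
        unfolding gg.normalized_cells_def by (auto simp: G)
      have n: "trunc n c = c" "\<And>m. m < n \<Longrightarrow> trunc m c = seq_one"
        using c inj_onD[OF e] sequences_closed[OF c(1)] by blast+
      have "c k = single n (c n) k" for k
      proof -
        consider "k < n" | "k = n" | "n < k" by linarith
        then show ?thesis
        proof cases
          case 1
          then show ?thesis using fun_cong[OF n(2)[OF 1], of k] by (simp add: trunc_def seq_one_def single_def)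
        next
          case 3
          then show ?thesis using fun_cong[OF n(1), of k] by (simp add: trunc_def single_def)
        qed (simp add: single_def)
      qed
      then have "c = single n (c n)" ..
      then show "y \<in> (\<lambda>x. e (single n x)) ` carrier (grp C n)"
        using c(2) sequencesD[OF c(1)] by (metis image_eqI)
    qed
  qed
  have single: "single n x \<in> sequences" if "x \<in> carrier (grp C n)" for n x
    using sequences_closed(5)[OF seq_one_closed that] .
  have single_mult: "seq_mult (single n x) (single n y) = single n (x \<otimes>\<^bsub>grp C n\<^esub> y)" for n x y
    by (auto simp: seq_mult_def single_def fun_eq_iff)
  have single_bd: "trunc_bd n (single (Suc n) x) = single n (bd C n x)"
    if "x \<in> carrier (grp C (Suc n))" for n x
    using that by (auto simp: trunc_bd_def single_def fun_eq_iff)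
  have single_self: "single n x n = x" for n x
    by (simp add: single_def)
  define f where "f n = restrict (\<lambda>y. d y n) (gg.normalized_cells n)" for n
  define g where "g n = restrict (\<lambda>x. e (single n x)) (carrier (grp C n))" for n
  have f: "f n (e (single n x)) = x" if "x \<in> carrier (grp C n)" for n x
    using that by (simp add: f_def cells d single single_self)
  have g: "g n x = e (single n x)" if "x \<in> carrier (grp C n)" for n x
    using that by (simp add: g_def)
  show thesis
  proof (rule that[OF A sel(1)])
    show "chain_map (normalized_complex ?A) C f"
      unfolding chain_map_def A.grp_normalized_complex A.bd_normalized_complex sel
      by (auto simp: hom_def cells G single single_mult single_bd f) (simp add: f_def cells)
    show "chain_map C (normalized_complex ?A) g"
      unfolding chain_map_def A.grp_normalized_complex A.bd_normalized_complex sel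
      by (auto simp: hom_def cells G single single_mult single_bd g) (simp add: g_def)
  qed (auto simp: A.carrier_normalized_complex sel cells f g)
qed

end

section \<open>Isomorphisms of complexes and the final comparison\<close>

lemma inverse_arrows_Ch:
  assumes "C \<in> small_complexes U" "D \<in> small_complexes U" "chain_map C D f" "chain_map D C g"
    and "\<And>n x. x \<in> carrier (grp C n) \<Longrightarrow> g n (f n x) = x"
    and "\<And>n y. y \<in> carrier (grp D n) \<Longrightarrow> f n (g n y) = y"
  shows "inverse_arrows (Ch U) C (C, f, D) (D, g, C) D"
  using assms
  by (auto simp: inverse_arrows_def in_hom_Ch Ch_Comp Ch_Ident compose_def restrict_def fun_eq_iff)

text \<open>Conjugating an arrow by chosen isomorphisms must not leave the class of weak
  equivalences; this supplies the required fact that isomorphisms belong to it.\<close>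

lemma quasi_iso_inverse_arrows:
  assumes "inverse_arrows (Ch U) C a b D"
  obtains f where "a = (C, f, D)" "quasi_iso C D f"
proof -
  obtain f g where fg: "a = (C, f, D)" "b = (D, g, C)" "chain_map C D f" "chain_map D C g"
      "C \<in> small_complexes U" "D \<in> small_complexes U"
    using assms by (auto simp: inverse_arrows_def in_hom_Ch)
  have "(\<lambda>n. compose (carrier (grp C n)) (g n) (f n)) = (\<lambda>n. restrict (\<lambda>x. x) (carrier (grp C n)))"
    using assms fg(1,2) by (simp add: inverse_arrows_def Ch_Comp Ch_Ident)
  then have "g n (f n x) = x" if "x \<in> carrier (grp C n)" for n x
    using that by (auto simp: compose_def fun_eq_iff restrict_def) metis
  moreover have "(\<lambda>n. compose (carrier (grp D n)) (f n) (g n)) = (\<lambda>n. restrict (\<lambda>x. x) (carrier (grp D n)))"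
    using assms fg(1,2) by (simp add: inverse_arrows_def Ch_Comp Ch_Ident)
  then have "f n (g n y) = y" if "y \<in> carrier (grp D n)" for n y
    using that by (auto simp: compose_def fun_eq_iff restrict_def) metis
  ultimately have "quasi_iso C D f"
    using fg by (intro quasi_iso_of_inverse) (auto simp: small_complexes_def)
  with fg(1) show thesis by (rule that)
qed

text \<open>The coded direct sum is small because the universe is closed under countable unions and
  under passing to sets of no larger cardinality.\<close>

lemma normalized_complex_ess_surj:
  assumes U: "universe U" and C: "C \<in> Obj (Ch U)"
  shows "\<exists>A\<in>Obj (Pic_omega U). \<exists>f g. inverse_arrows (Ch U) (normalized_complex A) f g C"
proof -
  have C': "C \<in> small_complexes U" using C by (simp add: Ch_def)
  then interpret complex C by unfold_locales (simp add: small_complexes_def)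
  obtain e where e: "inj_on e sequences" "e ` sequences \<in> U"
    unfolding sequences_def
    using universe_finite_support[OF U, of "\<lambda>n. carrier (grp C n)" "\<lambda>n. \<one>\<^bsub>grp C n\<^esub>"] C'
    by (auto simp: small_complexes_def)
  obtain A f g where A: "picard_category A" "Cells (ocat A) = e ` sequences"
    and fg: "chain_map (normalized_complex A) C f" "chain_map C (normalized_complex A) g"
    "\<And>n x. x \<in> carrier (grp (normalized_complex A) n) \<Longrightarrow> g n (f n x) = x"
    "\<And>n y. y \<in> carrier (grp C n) \<Longrightarrow> f n (g n y) = y"
    using picard_of_complex[OF e(1)] by metis
  have small: "A \<in> small_picards U" using A e(2) by (simp add: small_picards_def)
  then have "A \<in> Obj (Pic_omega U)" by (simp add: Pic_omega_def)
  moreover have "inverse_arrows (Ch U) (normalized_complex A) (normalized_complex A, f, C)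
      (C, g, normalized_complex A) C"
    by (rule inverse_arrows_Ch[OF small_normalized_complex[OF U small] C' fg])
  ultimately show ?thesis by blast
qed

theorem corollary3p9:
  fixes U :: "'u set set"
  assumes "universe U"
  shows "equivalent_categories (derived_category U) (Ho_Pic_omega U)"
  unfolding derived_category_def Ho_Pic_omega_def
proof (rule equivalent_localizations_ff_es[OF category_Pic_omega category_Ch
      functor_normalized[OF assms] normalized_arrow_full normalized_arrow_faithful
      normalized_complex_ess_surj[OF assms]])
  let ?V = "{(C, f, D). (C, f, D) \<in> Arr (Ch U) \<and> quasi_iso C D f}"
  let ?W = "{(A, F, B). (A, F, B) \<in> Arr (Pic_omega U) \<and> omega_equivalence (ocat A) (ocat B) F}"
  \<comment> \<open>Both directions matter: weak equivalences have to be preserved by normalization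
    and, through conjugation, by its quasi-inverse.\<close>
  show "a \<in> ?W \<longleftrightarrow> normalized_arrow a \<in> ?V" if a: "a \<in> Arr (Pic_omega U)" for a
  proof -
    obtain A F B where F: "a = (A, F, B)" by (cases a)
    moreover have "picard_category A" "picard_category B" "additive_functor A B F"
      using a F by (auto simp: Pic_omega_def small_picards_def)
    ultimately show ?thesis
      using a functor_arrD[OF functor_normalized[OF assms] a] omega_equivalence_iff
      by (simp add: normalized_arrow_def)
  qed
  show "a \<in> ?V" if i: "inverse_arrows (Ch U) C a b D" for C a b D
  proof -
    obtain f where "a = (C, f, D)" "quasi_iso C D f"
      using quasi_iso_inverse_arrows[OF i] .
    moreover have "in_hom (Ch U) C a D"
      using i by (simp add: inverse_arrows_def)
    ultimately show ?thesis by (simp add: in_hom_def)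
  qed
  show "Comp (Ch U) b a \<in> ?V"
    if ab: "in_hom (Ch U) C a D" "in_hom (Ch U) D b E" "a \<in> ?V" "b \<in> ?V" for C a D b E
  proof -
    have "Comp (Ch U) b a \<in> Arr (Ch U)"
      using in_hom_Comp[OF category_Ch ab(1,2)] by (rule in_homD)
    then show ?thesis
      using ab by (auto simp: in_hom_Ch Ch_Comp small_complexes_def intro!: quasi_iso_comp)
  qed
qed

end
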